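(* Let $G$ be a topological group. 1. If $G$ acts (resp. acts properly) continuously by affine isometries on a Banach space $B$, then there exists a structure $(G,\mathcal P,F(\mathcal P))$ of space with labelled partitions on the set $G$ such that $G$ acts (resp. acts properly) continuously by automorphisms on $(G,\mathcal P,F(\mathcal P))$ via its left-action on itself. Moreover, there exists a linear isometric embedding $F(\mathcal P)\hookrightarrow B$. 2. If $G$ acts (resp. acts properly) continuously by automorphisms on a space with labelled partitions $(X,\mathcal P,F(\mathcal P))$, then there exists a (resp. proper) continuous isometric affine action of $G$ on a Banach space $B$. Moreover, $B$ is a closed subspace of $F(\mathcal P)$.
   Context: All topological groups are assumed Hausdorff. $\mathbb K$ denotes $\mathbb R$ or $\mathbb C$, and Banach spaces are over $\mathbb K$. Spaces with labelled partitions. A labelling function on a set $X$ is a function $p:X\to\mathbb K$. For a set $\mathcal P$ of labelling functions on $X$, the separation map $c$ assigns to $(x,y)\in X\times X$ the function $c(x,y):\mathcal P\to\mathbb K$, $c(x,y)(p)=p(x)-p(y)$. A space with labelled partitions is a triple $(X,\mathcal P,F(\mathcal P))$, where $X$ is a set, $\mathcal P$ is a set of labelling functions on $X$, and $F(\mathcal P)$ is the quotient of a semi-normed space $(\mathcal F(\mathcal P),\|\cdot\|)$ of $\mathbb K$-valued functions on $\mathcal P$ by its subspace $\{\xi : \|\xi\|=0\}$, such that $F(\mathcal P)$ is a Banach space and $c(x,y)\in\mathcal F(\mathcal P)$ for all $x,y\in X$. Elements of $F(\mathcal P)$ are written as functions on $\mathcal P$ (representatives in $\mathcal F(\mathcal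 P)$). The labelled partitions pseudo-metric on $X$ is $d(x,y)=\|c(x,y)\|$. Homomorphisms. A map $f:X\to X'$ is a homomorphism of spaces with labelled partitions from $(X,\mathcal P,F(\mathcal P))$ to $(X',\mathcal P',F'(\mathcal P'))$ if: (i) for every $p'\in\mathcal P'$, $\Phi_f(p'):=p'\circ f$ belongs to $\mathcal P$; (ii) for every $\xi\in F(\mathcal P)$, $\xi\circ\Phi_f$ belongs to $F'(\mathcal P')$ and has the same norm as $\xi$ (read at the level of representatives). An automorphism of $(X,\mathcal P,F(\mathcal P))$ is a bijection $f:X\to X$ such that $f$ and $f^{-1}$ are homomorphisms from $(X,\mathcal P,F(\mathcal P))$ to itself. Actions. A group acts by automorphisms on $(X,\mathcal P,F(\mathcal P))$ if it acts on $X$ and each element acts as an automorphism. Such an action of a topological group $G$ is continuous if for each $x\in X$ the orbit map $g\mapsto gx$ from $G$ to $(X,d)$ is continuous; it is proper if it is metrically proper on $(X,d)$, i.e. for some (equivalently all) $x_0\in X$ and all $R\ge 0$ the set $\{g\in G : d(gx_0,x_0)\le R\}$ is relatively compact in $G$. A continuous isometric affine action of $G$ on a Banach space $B$ is an action $\alpha$ of $G$ on $B$ by affine isometries such that each orbit map $g\mapsto\alpha(g)x$ is continuous. It is proper if it is metrically proper on $B$ with the norm metric; equivalently $\|\alpha(g)0\|\to+\infty$ as $g\to\infty$. *)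

theory Defs
  imports "HOL-Analysis.Analysis" "HOL-Algebra.Module" "HOL-Algebra.AbelCoset" "HOL-Algebra.Group_Action"
begin

text \<open>The scalar field is a subset \<open>K\<close> of the complex numbers, viewed as a ring with carrier \<open>K\<close>.
  It is used with \<open>K = \<real>\<close> and \<open>K = UNIV\<close>, so that one development covers real and complex scalars.
  Labelling functions and functions on a set of labelling functions are
  extensional functions with values in \<open>K\<close>.\<close>

definition scalar_ring :: "complex set \<Rightarrow> complex ring" where
  "scalar_ring K = \<lparr>carrier = K, mult = (*), one = 1, zero = 0, add = (+)\<rparr>"

lemma cring_scalar_ring:
  assumes "K = \<real> \<or> K = UNIV"
  shows "cring (scalar_ring K)"
proof -
  have uminus: "- x \<in> K" if "x \<in> K" for x
    using assms that by auto
  show ?thesis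
  proof (rule cringI)
    show "abelian_group (scalar_ring K)"
    proof (rule abelian_groupI)
      show "\<exists>y\<in>carrier (scalar_ring K). y \<oplus>\<^bsub>scalar_ring K\<^esub> x = \<zero>\<^bsub>scalar_ring K\<^esub>"
        if "x \<in> carrier (scalar_ring K)" for x
        using that uminus[of x] by (auto simp: scalar_ring_def intro!: bexI[of _ "- x"])
    qed (use assms in \<open>auto simp: scalar_ring_def\<close>)
    show "comm_monoid (scalar_ring K)"
      by (rule comm_monoidI) (use assms in \<open>auto simp: scalar_ring_def\<close>)
  qed (simp add: scalar_ring_def algebra_simps)
qed


section \<open>Semi-normed spaces and Banach spaces\<close>

text \<open>The fields \<open>mult\<close> and \<open>one\<close>, inherited from the ring record, play no role.\<close>

record 'v normed_module = "(complex, 'v) module" +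
  vnorm :: "'v \<Rightarrow> real"

locale seminormed_space =
  Module.module "scalar_ring K" V
  for K :: "complex set" and V :: "('v, 'z) normed_module_scheme" (structure) +
  assumes vnorm_nonneg: "x \<in> carrier V \<Longrightarrow> 0 \<le> vnorm V x"
    and vnorm_triangle:
      "\<lbrakk>x \<in> carrier V; y \<in> carrier V\<rbrakk> \<Longrightarrow> vnorm V (x \<oplus> y) \<le> vnorm V x + vnorm V y"
    and vnorm_smult:
      "\<lbrakk>a \<in> K; x \<in> carrier V\<rbrakk> \<Longrightarrow> vnorm V (a \<odot>\<^bsub>V\<^esub> x) = cmod a * vnorm V x"

locale normed_space = seminormed_space +
  assumes vnorm_definite: "\<lbrakk>x \<in> carrier V; vnorm V x = 0\<rbrakk> \<Longrightarrow> x = \<zero>"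

text \<open>The locale \<open>Metric_space\<close> requires a distance to be non-negative and symmetric on the whole type,
  hence the value \<open>0\<close> outside the carrier.\<close>

definition vdist :: "('v, 'z) normed_module_scheme \<Rightarrow> 'v \<Rightarrow> 'v \<Rightarrow> real" where
  "vdist V x y = (if x \<in> carrier V \<and> y \<in> carrier V then vnorm V (x \<ominus>\<^bsub>V\<^esub> y) else 0)"

lemma (in seminormed_space) vnorm_zero: "vnorm V \<zero> = 0"
proof -
  have "(0::complex) \<in> K"
    using R.zero_closed by (simp add: scalar_ring_def)
  then have "vnorm V ((0::complex) \<odot>\<^bsub>V\<^esub> \<zero>) = cmod 0 * vnorm V \<zero>"
    by (rule vnorm_smult) simp
  moreover have "(0::complex) \<odot>\<^bsub>V\<^esub> \<zero> = \<zero>"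
    using smult_l_null[of "\<zero>"] by (simp add: scalar_ring_def)
  ultimately show ?thesis by simp
qed

lemma (in seminormed_space) vnorm_uminus:
  assumes "x \<in> carrier V"
  shows "vnorm V (\<ominus> x) = vnorm V x"
proof -
  let ?m = "\<ominus>\<^bsub>scalar_ring K\<^esub> \<one>\<^bsub>scalar_ring K\<^esub>"
  have m: "?m \<in> K"
    using R.a_inv_closed[OF R.one_closed] by (simp add: scalar_ring_def)
  have "?m \<oplus>\<^bsub>scalar_ring K\<^esub> \<one>\<^bsub>scalar_ring K\<^esub> = \<zero>\<^bsub>scalar_ring K\<^esub>"
    by (rule R.l_neg) simp
  then have "?m + 1 = 0"
    by (simp add: scalar_ring_def)
  then have "cmod ?m = 1"
    by (metis add_eq_0_iff norm_minus_cancel norm_one)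
  moreover have "\<ominus> x = ?m \<odot>\<^bsub>V\<^esub> x"
    using smult_l_minus[OF R.one_closed assms] assms by simp
  ultimately show ?thesis
    using vnorm_smult[OF m assms] by simp
qed

lemma (in normed_space) Metric_space_vdist: "Metric_space (carrier V) (vdist V)"
proof
  show "0 \<le> vdist V x y" for x y
    by (simp add: vdist_def vnorm_nonneg)
  show "vdist V x y = vdist V y x" for x y
  proof (cases "x \<in> carrier V \<and> y \<in> carrier V")
    case True
    then have "\<ominus> (x \<ominus> y) = y \<ominus> x"
      by (simp add: a_minus_def M.minus_add M.a_comm)
    then show ?thesis
      using True vnorm_uminus[of "x \<ominus> y"] by (simp add: vdist_def)
  qed (auto simp: vdist_def)
  show "vdist V x y = 0 \<longleftrightarrow> x = y" if xy: "x \<in> carrier V" "y \<in> carrier V" for x y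
  proof
    assume "vdist V x y = 0"
    then have "x \<ominus> y = \<zero>"
      using xy by (intro vnorm_definite) (simp_all add: vdist_def)
    then have "\<ominus> (\<ominus> y) = x"
      using xy by (intro M.minus_equality) (simp_all add: a_minus_def)
    then show "x = y"
      using xy by simp
  next
    assume "x = y"
    then show "vdist V x y = 0"
      using xy by (simp add: vdist_def vnorm_zero a_minus_def M.r_neg)
  qed
  show "vdist V x z \<le> vdist V x y + vdist V y z"
    if "x \<in> carrier V" "y \<in> carrier V" "z \<in> carrier V" for x y z
  proof -
    have "x \<ominus> z = (x \<ominus> y) \<oplus> (y \<ominus> z)"
      using that by (simp add: a_minus_def M.a_assoc M.r_neg1)
    then show ?thesis
      using that vnorm_triangle[of "x \<ominus> y" "y \<ominus> z"] by (simp add: vdist_def)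
  qed
qed

definition banach_space :: "complex set \<Rightarrow> ('v, 'z) normed_module_scheme \<Rightarrow> bool" where
  "banach_space K V \<longleftrightarrow> normed_space K V \<and> Metric_space.mcomplete (carrier V) (vdist V)"

definition closed_subspace ::
    "complex set \<Rightarrow> 'v set \<Rightarrow> ('v, 'z) normed_module_scheme \<Rightarrow> bool" where
  "closed_subspace K S V \<longleftrightarrow>
     submodule S (scalar_ring K) V \<and> closedin (Metric_space.mtopology (carrier V) (vdist V)) S"

definition linear_map ::
    "complex set \<Rightarrow> ('v, 'y) normed_module_scheme \<Rightarrow> ('w, 'z) normed_module_scheme \<Rightarrow>
     ('v \<Rightarrow> 'w) \<Rightarrow> bool" where
  "linear_map K V W L \<longleftrightarrow>
     L \<in> hom (add_monoid V) (add_monoid W) \<and>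
     (\<forall>a\<in>K. \<forall>x\<in>carrier V. L (a \<odot>\<^bsub>V\<^esub> x) = a \<odot>\<^bsub>W\<^esub> L x)"

definition linear_isometric_embedding ::
    "complex set \<Rightarrow> ('v, 'y) normed_module_scheme \<Rightarrow> ('w, 'z) normed_module_scheme \<Rightarrow>
     ('v \<Rightarrow> 'w) \<Rightarrow> bool" where
  "linear_isometric_embedding K V W L \<longleftrightarrow>
     linear_map K V W L \<and> (\<forall>x\<in>carrier V. vnorm W (L x) = vnorm V x)"

definition null_subspace :: "('v, 'z) normed_module_scheme \<Rightarrow> 'v set" where
  "null_subspace V = {x \<in> carrier V. vnorm V x = 0}"

text \<open>The quotient of a semi-normed space by its null subspace. The semi-norm is constant on each
  coset, so that \<open>the_elem\<close> selects its value there.\<close>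

definition null_quotient :: "('v, 'z) normed_module_scheme \<Rightarrow> 'v set normed_module" where
  "null_quotient V =
     \<lparr>carrier = a_rcosets\<^bsub>V\<^esub> (null_subspace V),
      mult = undefined,
      one = undefined,
      zero = null_subspace V,
      add = set_add V,
      smult = (\<lambda>a A. \<Union>x\<in>A. null_subspace V +>\<^bsub>V\<^esub> (a \<odot>\<^bsub>V\<^esub> x)),
      vnorm = (\<lambda>A. the_elem (vnorm V ` A))\<rparr>"

lemma (in seminormed_space) abelian_subgroup_null_subspace:
  "abelian_subgroup (null_subspace V) V"
proof (rule abelian_subgroupI3)
  show "additive_subgroup (null_subspace V) V"
  proof (rule additive_subgroup.intro, rule M.a_group[THEN group.subgroupI])
    show "null_subspace V \<subseteq> carrier (add_monoid V)"
      by (auto simp: null_subspace_def)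
    show "null_subspace V \<noteq> {}"
      using vnorm_zero by (auto simp: null_subspace_def)
    show "inv\<^bsub>add_monoid V\<^esub> x \<in> null_subspace V" if "x \<in> null_subspace V" for x
      using that vnorm_uminus[of x]
      by (auto simp: null_subspace_def a_inv_def[symmetric])
    show "x \<otimes>\<^bsub>add_monoid V\<^esub> y \<in> null_subspace V"
      if "x \<in> null_subspace V" "y \<in> null_subspace V" for x y
      using that vnorm_triangle[of x y] vnorm_nonneg[of "x \<oplus> y"]
      by (auto simp: null_subspace_def)
  qed
qed (rule M.abelian_group_axioms)

lemma (in seminormed_space) vnorm_null_quotient:
  assumes x: "x \<in> carrier V"
  shows "vnorm (null_quotient V) (null_subspace V +> x) = vnorm V x"
proof -
  interpret N: abelian_subgroup "null_subspace V" V
    by (rule abelian_subgroup_null_subspace)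
  have "vnorm V y = vnorm V x" if "y \<in> null_subspace V +> x" for y
  proof -
    from that obtain n where n: "n \<in> carrier V" "vnorm V n = 0" and y: "y = n \<oplus> x"
      unfolding a_r_coset_def' null_subspace_def by blast
    have "x = \<ominus> n \<oplus> y"
      using n x y by (simp add: M.r_neg1)
    then have "vnorm V x \<le> vnorm V y"
      using vnorm_triangle[of "\<ominus> n" y] vnorm_uminus[of n] n x y by simp
    moreover have "vnorm V y \<le> vnorm V x"
      using vnorm_triangle[of n x] n x y by simp
    ultimately show ?thesis by simp
  qed
  moreover have "x \<in> null_subspace V +> x"
    using x by (rule N.a_rcos_self)
  ultimately have "vnorm V ` (null_subspace V +> x) = {vnorm V x}"
    by blast
  then show ?thesis
    by (simp add: null_quotient_def)
qed

lemma (in seminormed_space) add_null_quotient: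
  assumes "x \<in> carrier V" "y \<in> carrier V"
  shows "(null_subspace V +> x) \<oplus>\<^bsub>null_quotient V\<^esub> (null_subspace V +> y) =
    null_subspace V +> (x \<oplus> y)"
proof -
  interpret N: abelian_subgroup "null_subspace V" V
    by (rule abelian_subgroup_null_subspace)
  show ?thesis
    using N.a_rcos_sum[OF assms] by (simp add: null_quotient_def)
qed

lemma (in seminormed_space) smult_null_quotient:
  assumes a: "a \<in> K" and x: "x \<in> carrier V"
  shows "a \<odot>\<^bsub>null_quotient V\<^esub> (null_subspace V +> x) = null_subspace V +> (a \<odot>\<^bsub>V\<^esub> x)"
proof -
  have aR: "a \<in> carrier (scalar_ring K)"
    unfolding scalar_ring_def using a by simp
  interpret N: abelian_subgroup "null_subspace V" V
    by (rule abelian_subgroup_null_subspace)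
  have "null_subspace V +> (a \<odot>\<^bsub>V\<^esub> y) = null_subspace V +> (a \<odot>\<^bsub>V\<^esub> x)"
    if "y \<in> null_subspace V +> x" for y
  proof -
    from that obtain n where n: "n \<in> carrier V" "vnorm V n = 0" and y: "y = n \<oplus> x"
      unfolding a_r_coset_def' null_subspace_def by blast
    have "a \<odot>\<^bsub>V\<^esub> n \<in> null_subspace V"
      using vnorm_smult[OF a n(1)] n(2) smult_closed[OF aR n(1)]
      unfolding null_subspace_def mem_Collect_eq by (metis mult_zero_right)
    then have "a \<odot>\<^bsub>V\<^esub> n \<oplus> a \<odot>\<^bsub>V\<^esub> x \<in> null_subspace V +> (a \<odot>\<^bsub>V\<^esub> x)"
      unfolding a_r_coset_def' by blast
    moreover have "a \<odot>\<^bsub>V\<^esub> y = a \<odot>\<^bsub>V\<^esub> n \<oplus> a \<odot>\<^bsub>V\<^esub> x"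
      unfolding y by (rule smult_r_distr[OF aR n(1) x])
    ultimately have *: "a \<odot>\<^bsub>V\<^esub> y \<in> null_subspace V +> (a \<odot>\<^bsub>V\<^esub> x)"
      by simp
    show ?thesis
      by (rule N.a_repr_independence'[OF * smult_closed[OF aR x], symmetric])
  qed
  moreover have "x \<in> null_subspace V +> x"
    using x by (rule N.a_rcos_self)
  ultimately have "(\<Union>y\<in>null_subspace V +> x. null_subspace V +> (a \<odot>\<^bsub>V\<^esub> y)) =
      null_subspace V +> (a \<odot>\<^bsub>V\<^esub> x)"
    by blast
  then show ?thesis
    by (simp add: null_quotient_def)
qed


section \<open>Actions of topological groups\<close>

definition topological_group :: "('g, 'm) monoid_scheme \<Rightarrow> 'g topology \<Rightarrow> bool" where
  "topological_group G T \<longleftrightarrow>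
     group G \<and> topspace T = carrier G \<and> Hausdorff_space T \<and>
     continuous_map (prod_topology T T) T (\<lambda>(g, h). g \<otimes>\<^bsub>G\<^esub> h) \<and>
     continuous_map T T (\<lambda>g. inv\<^bsub>G\<^esub> g)"

text \<open>\<open>Metric_space.mtopology\<close> is not available for pseudo-metrics.\<close>

definition pseudometric_topology :: "'x set \<Rightarrow> ('x \<Rightarrow> 'x \<Rightarrow> real) \<Rightarrow> 'x topology" where
  "pseudometric_topology X d =
     topology (\<lambda>U. U \<subseteq> X \<and> (\<forall>x\<in>U. \<exists>r>0. {y \<in> X. d x y < r} \<subseteq> U))"

lemma openin_pseudometric_topology:
  "openin (pseudometric_topology X d) U \<longleftrightarrow>
     U \<subseteq> X \<and> (\<forall>x\<in>U. \<exists>r>0. {y \<in> X. d x y < r} \<subseteq> U)"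
proof -
  have "istopology (\<lambda>U. U \<subseteq> X \<and> (\<forall>x\<in>U. \<exists>r>0. {y \<in> X. d x y < r} \<subseteq> U))"
    unfolding istopology_def
  proof (intro conjI allI impI)
    fix S T
    assume S: "S \<subseteq> X \<and> (\<forall>x\<in>S. \<exists>r>0. {y \<in> X. d x y < r} \<subseteq> S)"
      and T: "T \<subseteq> X \<and> (\<forall>x\<in>T. \<exists>r>0. {y \<in> X. d x y < r} \<subseteq> T)"
    show "S \<inter> T \<subseteq> X"
      using S by blast
    show "\<forall>x\<in>S \<inter> T. \<exists>r>0. {y \<in> X. d x y < r} \<subseteq> S \<inter> T"
    proof
      fix x assume "x \<in> S \<inter> T"
      then obtain r s where "r > 0" "{y \<in> X. d x y < r} \<subseteq> S" "s > 0" "{y \<in> X. d x y < s} \<subseteq> T"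
        using S T by blast
      then show "\<exists>r>0. {y \<in> X. d x y < r} \<subseteq> S \<inter> T"
        by (intro exI[of _ "min r s"]) auto
    qed
  next
    fix \<K>
    assume *: "\<forall>S\<in>\<K>. S \<subseteq> X \<and> (\<forall>x\<in>S. \<exists>r>0. {y \<in> X. d x y < r} \<subseteq> S)"
    show "\<Union>\<K> \<subseteq> X"
      using * by blast
    show "\<forall>x\<in>\<Union>\<K>. \<exists>r>0. {y \<in> X. d x y < r} \<subseteq> \<Union>\<K>"
    proof
      fix x assume "x \<in> \<Union>\<K>"
      then obtain S where "S \<in> \<K>" "x \<in> S"
        by blast
      with * obtain r where "r > 0" "{y \<in> X. d x y < r} \<subseteq> S"
        by blast
      with \<open>S \<in> \<K>\<close> show "\<exists>r>0. {y \<in> X. d x y < r} \<subseteq> \<Union>\<K>"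
        by blast
    qed
  qed
  then show ?thesis
    by (simp add: pseudometric_topology_def topology_inverse')
qed

lemma (in Metric_space) pseudometric_topology_eq_mtopology:
  "pseudometric_topology M d = mtopology"
proof (rule topology_eq[THEN iffD2], intro allI)
  fix U
  have ball: "mball x r = {y \<in> M. d x y < r}" if "x \<in> M" for x r
    using that by (auto simp: mball_def)
  show "openin (pseudometric_topology M d) U \<longleftrightarrow> openin mtopology U"
  proof (cases "U \<subseteq> M")
    case True
    then have "(\<exists>r>0. {y \<in> M. d x y < r} \<subseteq> U) \<longleftrightarrow> (\<exists>r>0. mball x r \<subseteq> U)" if "x \<in> U" for x
      using ball that by (simp add: subset_iff)
    then show ?thesis
      unfolding openin_pseudometric_topology openin_mtopology by blast
  next
    case False
    then show ?thesis
      unfolding openin_pseudometric_topology openin_mtopology by blast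
  qed
qed

definition continuous_orbit_maps ::
    "'g topology \<Rightarrow> 'x set \<Rightarrow> ('x \<Rightarrow> 'x \<Rightarrow> real) \<Rightarrow> ('g \<Rightarrow> 'x \<Rightarrow> 'x) \<Rightarrow> bool" where
  "continuous_orbit_maps T X d \<phi> \<longleftrightarrow>
     (\<forall>x\<in>X. continuous_map T (pseudometric_topology X d) (\<lambda>g. \<phi> g x))"

definition metrically_proper ::
    "'g topology \<Rightarrow> 'x set \<Rightarrow> ('x \<Rightarrow> 'x \<Rightarrow> real) \<Rightarrow> ('g \<Rightarrow> 'x \<Rightarrow> 'x) \<Rightarrow> bool" where
  "metrically_proper T X d \<phi> \<longleftrightarrow>
     (\<exists>x0\<in>X. \<forall>R\<ge>0. compactin T (T closure_of {g \<in> topspace T. d (\<phi> g x0) x0 \<le> R}))"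

definition affine_isometry ::
    "complex set \<Rightarrow> ('v, 'z) normed_module_scheme \<Rightarrow> ('v \<Rightarrow> 'v) \<Rightarrow> bool" where
  "affine_isometry K B A \<longleftrightarrow>
     (\<exists>L. linear_map K B B L \<and> (\<exists>b\<in>carrier B. \<forall>x\<in>carrier B. A x = L x \<oplus>\<^bsub>B\<^esub> b)) \<and>
     (\<forall>x\<in>carrier B. \<forall>y\<in>carrier B. vdist B (A x) (A y) = vdist B x y)"

definition continuous_affine_isometric_action ::
    "complex set \<Rightarrow> ('g, 'm) monoid_scheme \<Rightarrow> 'g topology \<Rightarrow> ('v, 'z) normed_module_scheme \<Rightarrow>
     ('g \<Rightarrow> 'v \<Rightarrow> 'v) \<Rightarrow> bool" where
  "continuous_affine_isometric_action K G T B \<alpha> \<longleftrightarrow>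
     group_action G (carrier B) \<alpha> \<and>
     (\<forall>g\<in>carrier G. affine_isometry K B (\<alpha> g)) \<and>
     continuous_orbit_maps T (carrier B) (vdist B) \<alpha>"


section \<open>Spaces with labelled partitions\<close>

definition separation_map :: "('x \<Rightarrow> complex) set \<Rightarrow> 'x \<Rightarrow> 'x \<Rightarrow> (('x \<Rightarrow> complex) \<Rightarrow> complex)" where
  "separation_map P x y = (\<lambda>p\<in>P. p x - p y)"

text \<open>That the zero vector is the zero function follows from the clause on addition.\<close>

definition seminormed_function_space ::
    "complex set \<Rightarrow> 'p set \<Rightarrow> ('p \<Rightarrow> complex) normed_module \<Rightarrow> bool" where
  "seminormed_function_space K P V \<longleftrightarrow>
     seminormed_space K V \<and>
     carrier V \<subseteq> P \<rightarrow>\<^sub>E K \<and>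
     (\<forall>\<xi>\<in>carrier V. \<forall>\<eta>\<in>carrier V. \<xi> \<oplus>\<^bsub>V\<^esub> \<eta> = (\<lambda>p\<in>P. \<xi> p + \<eta> p)) \<and>
     (\<forall>a\<in>K. \<forall>\<xi>\<in>carrier V. a \<odot>\<^bsub>V\<^esub> \<xi> = (\<lambda>p\<in>P. a * \<xi> p))"

text \<open>In \<open>labelled_partitions_space K X P V\<close>, the argument \<open>V\<close> is the semi-normed space of
  representatives; the associated Banach space is \<open>null_quotient V\<close>.\<close>

definition labelled_partitions_space ::
    "complex set \<Rightarrow> 'x set \<Rightarrow> ('x \<Rightarrow> complex) set \<Rightarrow> (('x \<Rightarrow> complex) \<Rightarrow> complex) normed_module \<Rightarrow>
     bool" where
  "labelled_partitions_space K X P V \<longleftrightarrow>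
     P \<subseteq> X \<rightarrow>\<^sub>E K \<and>
     seminormed_function_space K P V \<and>
     banach_space K (null_quotient V) \<and>
     (\<forall>x\<in>X. \<forall>y\<in>X. separation_map P x y \<in> carrier V)"

definition labelled_partitions_dist ::
    "('x \<Rightarrow> complex) set \<Rightarrow> (('x \<Rightarrow> complex) \<Rightarrow> complex) normed_module \<Rightarrow> 'x \<Rightarrow> 'x \<Rightarrow> real" where
  "labelled_partitions_dist P V x y = vnorm V (separation_map P x y)"

text \<open>Here \<open>compose X p' f\<close> is the restriction to \<open>X\<close> of the composition of \<open>p'\<close> with \<open>f\<close>.\<close>

definition labelled_partitions_hom ::
    "'x set \<Rightarrow> ('x \<Rightarrow> complex) set \<Rightarrow> (('x \<Rightarrow> complex) \<Rightarrow> complex) normed_module \<Rightarrow>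
     'y set \<Rightarrow> ('y \<Rightarrow> complex) set \<Rightarrow> (('y \<Rightarrow> complex) \<Rightarrow> complex) normed_module \<Rightarrow>
     ('x \<Rightarrow> 'y) \<Rightarrow> bool" where
  "labelled_partitions_hom X P V X' P' V' f \<longleftrightarrow>
     f \<in> X \<rightarrow> X' \<and>
     (\<forall>p'\<in>P'. compose X p' f \<in> P) \<and>
     (\<forall>\<xi>\<in>carrier V.
        compose P' \<xi> (\<lambda>p'. compose X p' f) \<in> carrier V' \<and>
        vnorm V' (compose P' \<xi> (\<lambda>p'. compose X p' f)) = vnorm V \<xi>)"

definition labelled_partitions_aut ::
    "'x set \<Rightarrow> ('x \<Rightarrow> complex) set \<Rightarrow> (('x \<Rightarrow> complex) \<Rightarrow> complex) normed_module \<Rightarrow>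
     ('x \<Rightarrow> 'x) \<Rightarrow> bool" where
  "labelled_partitions_aut X P V f \<longleftrightarrow>
     bij_betw f X X \<and>
     labelled_partitions_hom X P V X P V f \<and>
     labelled_partitions_hom X P V X P V (inv_into X f)"

definition continuous_automorphism_action ::
    "('g, 'm) monoid_scheme \<Rightarrow> 'g topology \<Rightarrow> 'x set \<Rightarrow> ('x \<Rightarrow> complex) set \<Rightarrow>
     (('x \<Rightarrow> complex) \<Rightarrow> complex) normed_module \<Rightarrow> ('g \<Rightarrow> 'x \<Rightarrow> 'x) \<Rightarrow> bool" where
  "continuous_automorphism_action G T X P V \<phi> \<longleftrightarrow>
     group_action G X \<phi> \<and>
     (\<forall>g\<in>carrier G. labelled_partitions_aut X P V (\<phi> g)) \<and>
     continuous_orbit_maps T X (labelled_partitions_dist P V) \<phi>"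

definition left_action :: "('g, 'm) monoid_scheme \<Rightarrow> 'g \<Rightarrow> 'g \<Rightarrow> 'g" where
  "left_action G g = (\<lambda>h\<in>carrier G. g \<otimes>\<^bsub>G\<^esub> h)"

end

theory Submission
  imports Defs
begin

text \<open>An affine isometric action \<open>\<alpha>\<close> on a Banach space \<open>B\<close> is determined by its linear part \<open>\<pi>\<close> and the
  cocycle \<open>b g = \<alpha> g 0\<close>, and a space with labelled partitions carries the same data in a different
  guise: the separation map \<open>c\<close> satisfies \<open>c x z = c x y + c y z\<close>, and automorphisms act
  by linear isometries on the functions on labels.

  From actions to partitions, the labels on \<open>G\<close> are the functions \<open>g \<mapsto> l (b g) + a\<close> with \<open>l\<close> a bounded
  functional and \<open>a\<close> a constant; the constants make the set of labels invariant under translations of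
  \<open>G\<close>. A vector \<open>v\<close> should become the function on labels with value \<open>l v\<close> at \<open>l \<circ> b + a\<close>. This is well
  defined when \<open>v\<close> is killed by all functionals that are constant on the range of \<open>b\<close>, and such vectors
  form a closed invariant subspace \<open>S\<close> containing every \<open>b g - b h\<close>. By the Hahn--Banach theorem
  (\<open>bounded_functionals_separate_points\<close>) different vectors of \<open>S\<close> give different functions, so the
  norm of \<open>B\<close> can be moved to the space of these functions. It is then a Banach space isometric to \<open>S\<close>,
  and the distance between \<open>g\<close> and \<open>h\<close> is \<open>\<parallel>b g - b h\<parallel>\<close>, which gives continuity and properness. The
  construction works for any map \<open>b\<close> from a set to a Banach space, and any self-map of the set that \<open>b\<close>
  intertwines with an affine isometry is a homomorphism
  (\<open>labelled_partitions_hom_pullback\<close>).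

  From partitions to actions, the group acts on the functions on labels by \<open>\<xi> \<mapsto> \<xi> \<circ> \<Phi>\<close>, which is
  isometric and therefore descends to a linear isometric representation \<open>\<pi>\<close> on the quotient \<open>F\<close>. With a base
  point \<open>x0\<close>, the class of \<open>c (g x0) x0\<close> is a cocycle \<open>b g\<close> of norm \<open>d (g x0) x0\<close>, and \<open>x \<mapsto> \<pi> g x + b g\<close>
  is an affine isometric action (\<open>affine_action_of_cocycle\<close>). Its orbit maps can fail to be continuous on \<open>F\<close>, so it is
  restricted to the space of vectors with continuous orbit map under \<open>\<pi>\<close>. This subspace
  is closed because the operators are isometries, invariant because right translations of \<open>G\<close> are
  continuous, and contains the cocycle because the action on the space of partitions is continuous.\<close>


section \<open>The Hahn--Banach theorem\<close>

lemma scalar_ring_simps [simp]: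
  "carrier (scalar_ring K) = K"
  "x \<otimes>\<^bsub>scalar_ring K\<^esub> y = x * y"
  "x \<oplus>\<^bsub>scalar_ring K\<^esub> y = x + y"
  "\<one>\<^bsub>scalar_ring K\<^esub> = 1"
  "\<zero>\<^bsub>scalar_ring K\<^esub> = 0"
  by (simp_all add: scalar_ring_def)

context seminormed_space
begin

lemma scalar_uminus:
  assumes "a \<in> K"
  shows "\<ominus>\<^bsub>scalar_ring K\<^esub> a = - a" "- a \<in> K"
proof -
  show "\<ominus>\<^bsub>scalar_ring K\<^esub> a = - a"
    using R.l_neg[of a] assms by (simp add: add_eq_0_iff2)
  then show "- a \<in> K"
    using R.a_inv_closed[of a] assms by simp
qed

lemma scalar_mem:
  "0 \<in> K" "1 \<in> K" "a \<in> K \<Longrightarrow> b \<in> K \<Longrightarrow> a + b \<in> K" "a \<in> K \<Longrightarrow> b \<in> K \<Longrightarrow> a * b \<in> K"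
  using R.zero_closed R.one_closed R.a_closed[of a b] R.m_closed[of a b] by auto

lemma smult_scalar_one: "x \<in> carrier V \<Longrightarrow> 1 \<odot>\<^bsub>V\<^esub> x = x"
  using smult_one[of x] by simp

lemma smult_mem: "a \<in> K \<Longrightarrow> x \<in> carrier V \<Longrightarrow> a \<odot>\<^bsub>V\<^esub> x \<in> carrier V"
  by (rule smult_closed) simp

text \<open>Only an inequality is required for scalar multiples, since infima preserve it directly; replacing
  \<open>t\<close> by its inverse gives equality.\<close>

definition sublinear :: "('v \<Rightarrow> real) \<Rightarrow> bool" where
  "sublinear p \<longleftrightarrow>
     (\<forall>x\<in>carrier V. \<forall>y\<in>carrier V. p (x \<oplus> y) \<le> p x + p y) \<and>
     (\<forall>t>0. \<forall>x\<in>carrier V. p (complex_of_real t \<odot>\<^bsub>V\<^esub> x) \<le> t * p x)"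

lemma sublinearD:
  assumes "sublinear p" "x \<in> carrier V"
  shows "y \<in> carrier V \<Longrightarrow> p (x \<oplus> y) \<le> p x + p y"
    and "t > 0 \<Longrightarrow> p (complex_of_real t \<odot>\<^bsub>V\<^esub> x) \<le> t * p x"
  using assms unfolding sublinear_def by blast+

context
  assumes reals: "\<real> \<subseteq> K"
begin

lemma of_real_scalar: "complex_of_real t \<in> K"
  using reals by auto

lemma of_real_smult_mem: "x \<in> carrier V \<Longrightarrow> complex_of_real t \<odot>\<^bsub>V\<^esub> x \<in> carrier V"
  by (rule smult_mem[OF of_real_scalar])

lemma of_real_smult_assoc:
  "x \<in> carrier V \<Longrightarrow>
    complex_of_real s \<odot>\<^bsub>V\<^esub> (complex_of_real t \<odot>\<^bsub>V\<^esub> x) = complex_of_real (s * t) \<odot>\<^bsub>V\<^esub> x"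
  using smult_assoc1[of "complex_of_real s" "complex_of_real t" x] of_real_scalar by simp

lemma sublinear_pos_homogeneous:
  assumes p: "sublinear p" and x: "x \<in> carrier V" and t: "t > 0"
  shows "p (complex_of_real t \<odot>\<^bsub>V\<^esub> x) = t * p x"
proof (rule antisym)
  have "complex_of_real (inverse t) \<odot>\<^bsub>V\<^esub> (complex_of_real t \<odot>\<^bsub>V\<^esub> x) = x"
    using of_real_smult_assoc[OF x, of "inverse t" t] t x by (simp add: smult_scalar_one)
  then have "p x \<le> inverse t * p (complex_of_real t \<odot>\<^bsub>V\<^esub> x)"
    using sublinearD(2)[OF p of_real_smult_mem[OF x], of "inverse t" t] t by simp
  then show "t * p x \<le> p (complex_of_real t \<odot>\<^bsub>V\<^esub> x)"
    using t by (simp add: field_simps)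
qed (rule sublinearD(2)[OF p x t])

lemma sublinear_zero: "sublinear p \<Longrightarrow> p \<zero> = 0"
  using sublinear_pos_homogeneous[of p \<zero> 2] of_real_scalar[of 2] by simp

lemma sublinear_nonneg_homogeneous:
  assumes "sublinear p" "x \<in> carrier V" "t \<ge> 0"
  shows "p (complex_of_real t \<odot>\<^bsub>V\<^esub> x) = t * p x"
  using assms sublinear_pos_homogeneous[of p x t] sublinear_zero[of p] smult_l_null[of x]
  by (cases "t = 0") auto

lemma sublinear_lower_bound:
  assumes "sublinear p" "x \<in> carrier V"
  shows "- p (\<ominus> x) \<le> p x"
  using sublinearD(1)[OF assms, of "\<ominus> x"] sublinear_zero[OF assms(1)] assms(2)
  by (simp add: M.r_neg)

text \<open>Among the sublinear functionals, those that are minimal for the pointwise order are the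
  linear ones: pulling \<open>p\<close> down as far as possible in the direction \<open>y\<close> gives the functional \<open>q\<close>
  below, and \<open>q = p\<close> forces \<open>p (x + y) = p x + p y\<close>.\<close>

lemma sublinear_shift:
  fixes p :: "'v \<Rightarrow> real" and y :: 'v
  assumes p: "sublinear p" and y: "y \<in> carrier V"
  defines "q \<equiv> \<lambda>x. INF t\<in>{0..}. p (x \<oplus> complex_of_real t \<odot>\<^bsub>V\<^esub> y) - t * p y"
  shows "sublinear q"
    and "\<And>x. x \<in> carrier V \<Longrightarrow> q x \<le> p x"
    and "\<And>x. x \<in> carrier V \<Longrightarrow> q x \<le> p (x \<oplus> y) - p y"
proof -
  note mem = of_real_smult_mem
  have q_eq: "q x = (INF t\<in>{0..}. p (x \<oplus> complex_of_real t \<odot>\<^bsub>V\<^esub> y) - t * p y)" for x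
    by (simp add: q_def)
  have bdd: "bdd_below ((\<lambda>t. p (x \<oplus> complex_of_real t \<odot>\<^bsub>V\<^esub> y) - t * p y) ` {0..})"
    if x: "x \<in> carrier V" for x
  proof (rule bdd_belowI2)
    fix t :: real assume "t \<in> {0..}"
    then have "t * p y = p (complex_of_real t \<odot>\<^bsub>V\<^esub> y)"
      using sublinear_nonneg_homogeneous[OF p y] by simp
    also have "\<dots> = p ((x \<oplus> complex_of_real t \<odot>\<^bsub>V\<^esub> y) \<oplus> \<ominus> x)"
      using x y mem[OF y, of t] by (simp add: M.a_comm[of x] M.a_assoc M.r_neg)
    also have "\<dots> \<le> p (x \<oplus> complex_of_real t \<odot>\<^bsub>V\<^esub> y) + p (\<ominus> x)"
      using x mem[OF y] by (intro sublinearD(1)[OF p]) auto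
    finally show "- p (\<ominus> x) \<le> p (x \<oplus> complex_of_real t \<odot>\<^bsub>V\<^esub> y) - t * p y"
      by simp
  qed
  have q_le: "q x \<le> p (x \<oplus> complex_of_real t \<odot>\<^bsub>V\<^esub> y) - t * p y"
    if "x \<in> carrier V" "t \<ge> 0" for x t
    unfolding q_def using that by (intro cINF_lower bdd) auto
  show "q x \<le> p x" if "x \<in> carrier V" for x
    using q_le[OF that, of 0] y that smult_l_null[of y] by simp
  show "q x \<le> p (x \<oplus> y) - p y" if "x \<in> carrier V" for x
    using q_le[OF that, of 1] y that by (simp add: smult_scalar_one)
  show "sublinear q"
    unfolding sublinear_def
  proof (intro conjI ballI allI impI)
    fix x x' assume x: "x \<in> carrier V" "x' \<in> carrier V"
    have *: "q (x \<oplus> x') \<le> (p (x \<oplus> complex_of_real s \<odot>\<^bsub>V\<^esub> y) - s * p y) +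
        (p (x' \<oplus> complex_of_real t \<odot>\<^bsub>V\<^esub> y) - t * p y)" if "s \<ge> 0" "t \<ge> 0" for s t
    proof -
      have "(x \<oplus> x') \<oplus> complex_of_real (s + t) \<odot>\<^bsub>V\<^esub> y =
          (x \<oplus> complex_of_real s \<odot>\<^bsub>V\<^esub> y) \<oplus> (x' \<oplus> complex_of_real t \<odot>\<^bsub>V\<^esub> y)"
        using smult_l_distr[of "complex_of_real s" "complex_of_real t" y] x y mem[OF y, of s] mem[OF y, of t]
        by (simp add: of_real_scalar M.a_ac)
      then have "p ((x \<oplus> x') \<oplus> complex_of_real (s + t) \<odot>\<^bsub>V\<^esub> y) \<le>
          p (x \<oplus> complex_of_real s \<odot>\<^bsub>V\<^esub> y) + p (x' \<oplus> complex_of_real t \<odot>\<^bsub>V\<^esub> y)"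
        using x mem[OF y] by (simp add: sublinearD(1)[OF p])
      then show ?thesis
        using q_le[of "x \<oplus> x'" "s + t"] x that by (simp add: algebra_simps)
    qed
    have "q (x \<oplus> x') - q x' \<le> p (x \<oplus> complex_of_real s \<odot>\<^bsub>V\<^esub> y) - s * p y" if "s \<ge> 0" for s
    proof -
      have "q (x \<oplus> x') - (p (x \<oplus> complex_of_real s \<odot>\<^bsub>V\<^esub> y) - s * p y) \<le> q x'"
        unfolding q_eq[of x'] using *[OF that] by (intro cINF_greatest) (auto simp: algebra_simps)
      then show ?thesis by simp
    qed
    then have "q (x \<oplus> x') - q x' \<le> q x"
      unfolding q_eq[of x] by (intro cINF_greatest) auto
    then show "q (x \<oplus> x') \<le> q x + q x'"
      by simp
  next
    fix s :: real and x assume s: "s > 0" and x: "x \<in> carrier V"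
    have "q (complex_of_real s \<odot>\<^bsub>V\<^esub> x) / s \<le> p (x \<oplus> complex_of_real t \<odot>\<^bsub>V\<^esub> y) - t * p y"
      if t: "t \<ge> 0" for t
    proof -
      have "complex_of_real s \<odot>\<^bsub>V\<^esub> x \<oplus> complex_of_real (s * t) \<odot>\<^bsub>V\<^esub> y =
          complex_of_real s \<odot>\<^bsub>V\<^esub> (x \<oplus> complex_of_real t \<odot>\<^bsub>V\<^esub> y)"
        using x y mem[OF y, of t]
        by (simp add: smult_r_distr of_real_scalar of_real_smult_assoc del: of_real_mult)
      then have "p (complex_of_real s \<odot>\<^bsub>V\<^esub> x \<oplus> complex_of_real (s * t) \<odot>\<^bsub>V\<^esub> y) =
          s * p (x \<oplus> complex_of_real t \<odot>\<^bsub>V\<^esub> y)"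
        using sublinear_pos_homogeneous[OF p _ s] x mem[OF y] by simp
      then have "q (complex_of_real s \<odot>\<^bsub>V\<^esub> x) \<le> s * (p (x \<oplus> complex_of_real t \<odot>\<^bsub>V\<^esub> y) - t * p y)"
        using q_le[OF mem[OF x], of "s * t" s] s t by (simp add: algebra_simps)
      then show ?thesis
        using s by (simp add: field_simps)
    qed
    then have "q (complex_of_real s \<odot>\<^bsub>V\<^esub> x) / s \<le> q x"
      unfolding q_eq[of x] by (intro cINF_greatest) auto
    then show "q (complex_of_real s \<odot>\<^bsub>V\<^esub> x) \<le> s * q x"
      using s by (simp add: field_simps)
  qed
qed

text \<open>Zorn's lemma applies because a sublinear \<open>p \<le> q\<close> satisfies \<open>p x \<ge> - p (- x) \<ge> - q (- x)\<close>, so that the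
  pointwise infimum of a chain exists.\<close>

lemma exists_minimal_sublinear:
  assumes q: "sublinear q"
  shows "\<exists>p. sublinear p \<and> (\<forall>x\<in>carrier V. p x \<le> q x) \<and>
    (\<forall>p'. sublinear p' \<longrightarrow> (\<forall>x\<in>carrier V. p' x \<le> p x) \<longrightarrow> (\<forall>x\<in>carrier V. p' x = p x))"
proof -
  define A where "A = {p \<in> extensional (carrier V). sublinear p \<and> (\<forall>x\<in>carrier V. p x \<le> q x)}"
  define below where "below p p' \<longleftrightarrow> (\<forall>x\<in>carrier V. p' x \<le> p x)" for p p' :: "'v \<Rightarrow> real"
  have restrict_A: "restrict p (carrier V) \<in> A"
    if "sublinear p" "\<forall>x\<in>carrier V. p x \<le> q x" for p
    using that by (simp add: A_def sublinear_def of_real_smult_mem)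
  have "\<exists>m\<in>A. \<forall>a\<in>A. below m a \<longrightarrow> a = m"
  proof (rule predicate_Zorn)
    show "partial_order_on A (relation_of below A)"
    proof (rule partial_order_on_relation_ofI)
      show "a = b" if "a \<in> A" "b \<in> A" "below a b" "below b a" for a b
        using that by (intro extensionalityI[of _ "carrier V"]) (auto simp: A_def below_def intro: antisym)
    qed (auto simp: below_def intro: order_trans)
  next
    fix C assume C: "C \<in> Chains (relation_of below A)"
    show "\<exists>u\<in>A. \<forall>a\<in>C. below a u"
    proof (cases "C = {}")
      case True
      then show ?thesis using restrict_A[OF q] by auto
    next
      case False
      have CA: "C \<subseteq> A" and total: "\<And>a b. a \<in> C \<Longrightarrow> b \<in> C \<Longrightarrow> below a b \<or> below b a"
        using C by (auto simp: Chains_def relation_of_def)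
      have sub: "sublinear p" if "p \<in> C" for p
        using that CA by (auto simp: A_def)
      define u where "u x = (INF p\<in>C. p x)" for x
      have bdd: "bdd_below ((\<lambda>p. p x) ` C)" if x: "x \<in> carrier V" for x
      proof (rule bdd_belowI2)
        fix p assume p: "p \<in> C"
        have "p (\<ominus> x) \<le> q (\<ominus> x)"
          using p CA x by (auto simp: A_def)
        then show "- q (\<ominus> x) \<le> p x"
          using sublinear_lower_bound[OF sub[OF p] x] by simp
      qed
      have u_le: "u x \<le> p x" if "x \<in> carrier V" "p \<in> C" for x p
        unfolding u_def using that by (intro cINF_lower bdd)
      have "sublinear u"
        unfolding sublinear_def
      proof (intro conjI ballI allI impI)
        fix x y assume x: "x \<in> carrier V" and y: "y \<in> carrier V"
        have *: "u (x \<oplus> y) \<le> p x + p' y" if pp: "p \<in> C" "p' \<in> C" for p p'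
        proof -
          \<comment> \<open>The smaller of the two functionals serves at both points.\<close>
          obtain r where r: "r \<in> C" "r x \<le> p x" "r y \<le> p' y"
            using total[OF pp] pp x y unfolding below_def by blast
          have "u (x \<oplus> y) \<le> r (x \<oplus> y)"
            using u_le r(1) x y by simp
          also have "\<dots> \<le> r x + r y"
            using sublinearD(1)[OF sub[OF r(1)] x y] .
          finally show ?thesis using r by simp
        qed
        have "u (x \<oplus> y) - p x \<le> u y" if "p \<in> C" for p
          unfolding u_def[of y] using *[OF that] False
          by (intro cINF_greatest) (auto simp: algebra_simps)
        then have "u (x \<oplus> y) - u y \<le> u x"
          unfolding u_def[of x] using False by (intro cINF_greatest) (auto simp: algebra_simps)
        then show "u (x \<oplus> y) \<le> u x + u y"
          by simp
      next
        fix t :: real and x assume t: "t > 0" and x: "x \<in> carrier V"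
        have "u (complex_of_real t \<odot>\<^bsub>V\<^esub> x) / t \<le> p x" if "p \<in> C" for p
          using u_le[OF of_real_smult_mem[OF x] that, of t] sublinearD(2)[OF sub[OF that] x t] t
          by (simp add: field_simps)
        then have "u (complex_of_real t \<odot>\<^bsub>V\<^esub> x) / t \<le> u x"
          unfolding u_def[of x] using False by (intro cINF_greatest) auto
        then show "u (complex_of_real t \<odot>\<^bsub>V\<^esub> x) \<le> t * u x"
          using t by (simp add: field_simps)
      qed
      moreover have "u x \<le> q x" if x: "x \<in> carrier V" for x
      proof -
        obtain p where p: "p \<in> C"
          using False by blast
        with CA x have "p x \<le> q x"
          by (auto simp: A_def)
        with u_le[OF x p] show ?thesis by simp
      qed
      ultimately show ?thesis
        using restrict_A[of u] u_le by (intro bexI[of _ "restrict u (carrier V)"]) (auto simp: below_def)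
    qed
  qed
  then obtain m where m: "m \<in> A" and min: "\<And>a. a \<in> A \<Longrightarrow> below m a \<Longrightarrow> a = m"
    by blast
  have "p' x = m x"
    if p': "sublinear p'" "\<forall>x\<in>carrier V. p' x \<le> m x" and x: "x \<in> carrier V" for p' x
  proof -
    have "\<forall>x\<in>carrier V. p' x \<le> q x"
      using p'(2) m unfolding A_def by fastforce
    then have "restrict p' (carrier V) = m"
      using p' by (intro min restrict_A) (auto simp: below_def)
    with x show ?thesis by (metis restrict_apply')
  qed
  with m show ?thesis
    unfolding A_def by blast
qed

text \<open>A norming functional at \<open>x0\<close>: a minimal sublinear functional below the shift of the norm in the
  direction \<open>x0\<close>, whose value at \<open>- x0\<close> is at most \<open>- vnorm V x0\<close>.\<close>

theorem real_Hahn_Banach: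
  assumes x0: "x0 \<in> carrier V"
  obtains f :: "'v \<Rightarrow> real"
  where "\<And>x y. x \<in> carrier V \<Longrightarrow> y \<in> carrier V \<Longrightarrow> f (x \<oplus> y) = f x + f y"
    and "\<And>t x. x \<in> carrier V \<Longrightarrow> f (complex_of_real t \<odot>\<^bsub>V\<^esub> x) = t * f x"
    and "\<And>x. x \<in> carrier V \<Longrightarrow> \<bar>f x\<bar> \<le> vnorm V x"
    and "vnorm V x0 \<le> f x0"
proof -
  have norm: "sublinear (vnorm V)"
    using vnorm_triangle vnorm_smult of_real_scalar by (auto simp: sublinear_def)
  obtain q where q: "sublinear q" "\<And>x. x \<in> carrier V \<Longrightarrow> q x \<le> vnorm V x"
      "\<And>x. x \<in> carrier V \<Longrightarrow> q x \<le> vnorm V (x \<oplus> x0) - vnorm V x0"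
    using sublinear_shift[OF norm x0] by blast
  obtain p where p: "sublinear p" and pq: "\<And>x. x \<in> carrier V \<Longrightarrow> p x \<le> q x"
    and min: "\<And>p' x. sublinear p' \<Longrightarrow> \<forall>x\<in>carrier V. p' x \<le> p x \<Longrightarrow> x \<in> carrier V \<Longrightarrow> p' x = p x"
    using exists_minimal_sublinear[OF q(1)] by blast
  \<comment> \<open>The shift of \<open>p\<close> in the direction \<open>y\<close> is sublinear and below \<open>p\<close>, hence equal to \<open>p\<close>.\<close>
  have add: "p (x \<oplus> y) = p x + p y" if x: "x \<in> carrier V" and y: "y \<in> carrier V" for x y
  proof (rule antisym)
    obtain p' where p': "sublinear p'" "\<And>x. x \<in> carrier V \<Longrightarrow> p' x \<le> p x"
        "\<And>x. x \<in> carrier V \<Longrightarrow> p' x \<le> p (x \<oplus> y) - p y"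
      using sublinear_shift[OF p y] by blast
    with min[of p' x] x show "p x + p y \<le> p (x \<oplus> y)"
      by fastforce
  qed (rule sublinearD(1)[OF p x y])
  have neg: "p (\<ominus> x) = - p x" if "x \<in> carrier V" for x
    using add[of x "\<ominus> x"] that sublinear_zero[OF p] by (simp add: M.r_neg)
  have hom: "p (complex_of_real t \<odot>\<^bsub>V\<^esub> x) = t * p x" if x: "x \<in> carrier V" for t x
  proof (cases "t \<ge> 0")
    case True
    then show ?thesis using sublinear_nonneg_homogeneous[OF p x] by simp
  next
    case False
    have "complex_of_real t \<odot>\<^bsub>V\<^esub> x = \<ominus> (complex_of_real (- t) \<odot>\<^bsub>V\<^esub> x)"
      using smult_l_minus[of "complex_of_real t" x] x of_real_scalar[of t]
      by (simp add: scalar_uminus of_real_smult_mem)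
    then show ?thesis
      using sublinear_nonneg_homogeneous[OF p x, of "- t"] False
        neg[OF of_real_smult_mem[OF x], of "- t"]
      by simp
  qed
  have p_le: "p x \<le> vnorm V x" if "x \<in> carrier V" for x
    using pq[OF that] q(2)[OF that] by simp
  show thesis
  proof (rule that[of p])
    show "\<bar>p x\<bar> \<le> vnorm V x" if "x \<in> carrier V" for x
      using p_le[OF that] p_le[of "\<ominus> x"] neg[OF that] vnorm_uminus[OF that] that by simp
    have "p (\<ominus> x0) \<le> vnorm V (\<ominus> x0 \<oplus> x0) - vnorm V x0"
      using pq[of "\<ominus> x0"] q(3)[of "\<ominus> x0"] x0 by simp
    then show "vnorm V x0 \<le> p x0"
      using neg[OF x0] x0 by (simp add: M.l_neg vnorm_zero)
  qed (use add hom in auto)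
qed

end

end

definition bounded_functional ::
    "complex set \<Rightarrow> ('v, 'z) normed_module_scheme \<Rightarrow> ('v \<Rightarrow> complex) \<Rightarrow> bool" where
  "bounded_functional K V l \<longleftrightarrow>
     l \<in> carrier V \<rightarrow> K \<and>
     (\<forall>x\<in>carrier V. \<forall>y\<in>carrier V. l (x \<oplus>\<^bsub>V\<^esub> y) = l x + l y) \<and>
     (\<forall>a\<in>K. \<forall>x\<in>carrier V. l (a \<odot>\<^bsub>V\<^esub> x) = a * l x) \<and>
     (\<exists>C. \<forall>x\<in>carrier V. cmod (l x) \<le> C * vnorm V x)"

text \<open>Over the complex numbers, a real functional \<open>f\<close> yields the complex functional
  \<open>\<lambda>x. f x - \<i> * f (\<i> x)\<close>, whose real part is \<open>f\<close>.\<close>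

theorem bounded_functionals_separate_points:
  assumes K: "K = \<real> \<or> K = UNIV"
    and V: "seminormed_space K V"
    and x0: "x0 \<in> carrier V" "vnorm V x0 \<noteq> 0"
  obtains l where "bounded_functional K V l" "l x0 \<noteq> 0"
proof -
  interpret seminormed_space K V by (rule V)
  have reals: "\<real> \<subseteq> K"
    using K by auto
  obtain f :: "'a \<Rightarrow> real"
  where add: "\<And>x y. x \<in> carrier V \<Longrightarrow> y \<in> carrier V \<Longrightarrow> f (x \<oplus>\<^bsub>V\<^esub> y) = f x + f y"
    and hom: "\<And>t x. x \<in> carrier V \<Longrightarrow> f (complex_of_real t \<odot>\<^bsub>V\<^esub> x) = t * f x"
    and bound: "\<And>x. x \<in> carrier V \<Longrightarrow> \<bar>f x\<bar> \<le> vnorm V x"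
    and f0: "vnorm V x0 \<le> f x0"
    using real_Hahn_Banach[OF reals x0(1)] by blast
  have f0: "f x0 \<noteq> 0"
    using f0 x0 vnorm_nonneg[OF x0(1)] by linarith
  show thesis
  proof (cases "K = \<real>")
    case True
    have "bounded_functional K V (\<lambda>x. of_real (f x))"
      unfolding bounded_functional_def True
      using add bound hom by (auto elim!: Reals_cases intro!: exI[of _ 1])
    with f0 show thesis by (intro that) auto
  next
    case False
    with K have U: "K = UNIV" by blast
    define l where "l x = Complex (f x) (- f (\<i> \<odot>\<^bsub>V\<^esub> x))" for x
    have mem: "a \<odot>\<^bsub>V\<^esub> x \<in> carrier V" if "x \<in> carrier V" for a x
      using that U by simp
    have decomp: "f (a \<odot>\<^bsub>V\<^esub> x) = Re a * f x + Im a * f (\<i> \<odot>\<^bsub>V\<^esub> x)" if x: "x \<in> carrier V" for a x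
    proof -
      have "a \<odot>\<^bsub>V\<^esub> x = (complex_of_real (Re a) + complex_of_real (Im a) * \<i>) \<odot>\<^bsub>V\<^esub> x"
        by (metis complex_eq mult.commute)
      also have "\<dots> = complex_of_real (Re a) \<odot>\<^bsub>V\<^esub> x \<oplus>\<^bsub>V\<^esub> complex_of_real (Im a) \<odot>\<^bsub>V\<^esub> (\<i> \<odot>\<^bsub>V\<^esub> x)"
        using smult_l_distr[of "complex_of_real (Re a)" "complex_of_real (Im a) * \<i>" x]
          smult_assoc1[of "complex_of_real (Im a)" \<i> x] x U by simp
      finally show ?thesis
        using x mem by (simp add: add hom)
    qed
    have l_hom: "l (a \<odot>\<^bsub>V\<^esub> x) = a * l x" if x: "x \<in> carrier V" for a x
    proof -
      have "\<i> \<odot>\<^bsub>V\<^esub> (a \<odot>\<^bsub>V\<^esub> x) = (\<i> * a) \<odot>\<^bsub>V\<^esub> x"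
        using smult_assoc1[of \<i> a x] x U by simp
      then show ?thesis
        using decomp[OF x, of a] decomp[OF x, of "\<i> * a"] by (simp add: l_def complex_eq_iff)
    qed
    have l_bound: "cmod (l x) \<le> 2 * vnorm V x" if x: "x \<in> carrier V" for x
    proof -
      have "cmod (l x) \<le> \<bar>f x\<bar> + \<bar>f (\<i> \<odot>\<^bsub>V\<^esub> x)\<bar>"
        using cmod_le[of "l x"] by (simp add: l_def)
      then show ?thesis
        using bound[OF x] bound[OF mem[OF x], of \<i>] vnorm_smult[of \<i> x] x U by simp
    qed
    have l_add: "l (x \<oplus>\<^bsub>V\<^esub> y) = l x + l y" if "x \<in> carrier V" "y \<in> carrier V" for x y
      using that mem smult_r_distr[of \<i> x y] U by (simp add: l_def add complex_eq_iff)
    have "bounded_functional K V l"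
      unfolding bounded_functional_def U using l_hom l_bound l_add by blast
    moreover have "l x0 \<noteq> 0"
      using f0 by (simp add: l_def complex_eq_iff)
    ultimately show thesis by (rule that)
  qed
qed



section \<open>Normed spaces and linear isometries\<close>

context seminormed_space
begin

lemma minus_mem: "x \<in> carrier V \<Longrightarrow> y \<in> carrier V \<Longrightarrow> x \<ominus> y \<in> carrier V"
  by (simp add: M.minus_eq)

lemma minus_add_cancel: "x \<in> carrier V \<Longrightarrow> y \<in> carrier V \<Longrightarrow> (x \<ominus> y) \<oplus> y = x"
  by (simp add: M.minus_eq M.a_assoc M.l_neg)

lemma add_minus_add_right:
  "x \<in> carrier V \<Longrightarrow> y \<in> carrier V \<Longrightarrow> z \<in> carrier V \<Longrightarrow> (x \<oplus> z) \<ominus> (y \<oplus> z) = x \<ominus> y"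
  using M.r_neg2[of z "\<ominus> y"] by (simp add: M.minus_eq M.minus_add M.a_assoc M.a_comm[of "\<ominus> y"])

lemma minus_self: "x \<in> carrier V \<Longrightarrow> x \<ominus> x = \<zero>"
  by (simp add: M.minus_eq M.r_neg)

lemma minus_zero_right: "x \<in> carrier V \<Longrightarrow> x \<ominus> \<zero> = x"
  by (simp add: M.minus_eq)

lemma vnorm_minus_triangle:
  assumes "x \<in> carrier V" "y \<in> carrier V" "z \<in> carrier V"
  shows "vnorm V (x \<ominus> z) \<le> vnorm V (x \<ominus> y) + vnorm V (y \<ominus> z)"
proof -
  have "x \<ominus> z = (x \<ominus> y) \<oplus> (y \<ominus> z)"
    using assms by (simp add: M.minus_eq M.a_assoc M.r_neg1)
  then show ?thesis
    using assms vnorm_triangle[of "x \<ominus> y" "y \<ominus> z"] by (simp add: minus_mem)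
qed

lemma vnorm_minus_commute:
  assumes "x \<in> carrier V" "y \<in> carrier V"
  shows "vnorm V (x \<ominus> y) = vnorm V (y \<ominus> x)"
proof -
  have "\<ominus> (x \<ominus> y) = y \<ominus> x"
    using assms by (simp add: M.minus_eq M.minus_add M.a_comm)
  then show ?thesis
    using vnorm_uminus[of "x \<ominus> y"] assms by (simp add: minus_mem)
qed

lemma vdist_eq: "x \<in> carrier V \<Longrightarrow> y \<in> carrier V \<Longrightarrow> vdist V x y = vnorm V (x \<ominus> y)"
  by (simp add: vdist_def)

lemma vdist_self: "x \<in> carrier V \<Longrightarrow> vdist V x x = 0"
  by (simp add: vdist_eq minus_self vnorm_zero)

lemma vdist_commute: "x \<in> carrier V \<Longrightarrow> y \<in> carrier V \<Longrightarrow> vdist V x y = vdist V y x"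
  by (simp add: vdist_eq vnorm_minus_commute)

lemma vdist_triangle:
  "x \<in> carrier V \<Longrightarrow> y \<in> carrier V \<Longrightarrow> z \<in> carrier V \<Longrightarrow> vdist V x z \<le> vdist V x y + vdist V y z"
  by (simp add: vdist_eq vnorm_minus_triangle)

end

lemma linear_mapD:
  assumes "linear_map K V W U"
  shows "x \<in> carrier V \<Longrightarrow> U x \<in> carrier W"
    and "x \<in> carrier V \<Longrightarrow> y \<in> carrier V \<Longrightarrow> U (x \<oplus>\<^bsub>V\<^esub> y) = U x \<oplus>\<^bsub>W\<^esub> U y"
    and "a \<in> K \<Longrightarrow> x \<in> carrier V \<Longrightarrow> U (a \<odot>\<^bsub>V\<^esub> x) = a \<odot>\<^bsub>W\<^esub> U x"
  using assms by (auto simp: linear_map_def hom_def)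

lemma linear_mapI:
  assumes "\<And>x. x \<in> carrier V \<Longrightarrow> U x \<in> carrier W"
    and "\<And>x y. x \<in> carrier V \<Longrightarrow> y \<in> carrier V \<Longrightarrow> U (x \<oplus>\<^bsub>V\<^esub> y) = U x \<oplus>\<^bsub>W\<^esub> U y"
    and "\<And>a x. a \<in> K \<Longrightarrow> x \<in> carrier V \<Longrightarrow> U (a \<odot>\<^bsub>V\<^esub> x) = a \<odot>\<^bsub>W\<^esub> U x"
  shows "linear_map K V W U"
  using assms by (auto simp: linear_map_def hom_def)

lemma linear_isometric_embeddingD:
  assumes "linear_isometric_embedding K V W U"
  shows "x \<in> carrier V \<Longrightarrow> U x \<in> carrier W"
    and "x \<in> carrier V \<Longrightarrow> y \<in> carrier V \<Longrightarrow> U (x \<oplus>\<^bsub>V\<^esub> y) = U x \<oplus>\<^bsub>W\<^esub> U y"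
    and "a \<in> K \<Longrightarrow> x \<in> carrier V \<Longrightarrow> U (a \<odot>\<^bsub>V\<^esub> x) = a \<odot>\<^bsub>W\<^esub> U x"
    and "x \<in> carrier V \<Longrightarrow> vnorm W (U x) = vnorm V x"
  using assms linear_mapD[of K V W U] by (auto simp: linear_isometric_embedding_def)

lemma linear_map_zero:
  assumes V: "seminormed_space K V" and W: "seminormed_space K W" and U: "linear_map K V W U"
  shows "U \<zero>\<^bsub>V\<^esub> = \<zero>\<^bsub>W\<^esub>"
proof -
  interpret V: seminormed_space K V by (rule V)
  interpret W: seminormed_space K W by (rule W)
  have "(0 :: complex) \<odot>\<^bsub>V\<^esub> \<zero>\<^bsub>V\<^esub> = \<zero>\<^bsub>V\<^esub>" "(0 :: complex) \<odot>\<^bsub>W\<^esub> U \<zero>\<^bsub>V\<^esub> = \<zero>\<^bsub>W\<^esub>"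
    using V.smult_l_null[of "\<zero>\<^bsub>V\<^esub>"] W.smult_l_null[of "U \<zero>\<^bsub>V\<^esub>"] linear_mapD(1)[OF U, of "\<zero>\<^bsub>V\<^esub>"]
    by auto
  then show ?thesis
    using linear_mapD(3)[OF U V.scalar_mem(1), of "\<zero>\<^bsub>V\<^esub>"] by simp
qed

lemma linear_map_minus:
  assumes V: "seminormed_space K V" and W: "seminormed_space K W" and U: "linear_map K V W U"
    and x: "x \<in> carrier V" and y: "y \<in> carrier V"
  shows "U (x \<ominus>\<^bsub>V\<^esub> y) = U x \<ominus>\<^bsub>W\<^esub> U y"
proof -
  interpret V: seminormed_space K V by (rule V)
  interpret W: seminormed_space K W by (rule W)
  have "U x = U (x \<ominus>\<^bsub>V\<^esub> y) \<oplus>\<^bsub>W\<^esub> U y"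
    using linear_mapD(2)[OF U V.minus_mem[OF x y] y] x y by (simp add: V.minus_add_cancel)
  then show ?thesis
    using linear_mapD(1)[OF U] x y V.minus_mem[OF x y]
    by (simp add: W.M.minus_eq W.M.a_assoc W.M.r_neg)
qed

lemma linear_isometry_vdist:
  assumes V: "seminormed_space K V" and W: "seminormed_space K W"
    and U: "linear_isometric_embedding K V W U"
    and x: "x \<in> carrier V" and y: "y \<in> carrier V"
  shows "vdist W (U x) (U y) = vdist V x y"
proof -
  have "U (x \<ominus>\<^bsub>V\<^esub> y) = U x \<ominus>\<^bsub>W\<^esub> U y"
    using linear_map_minus[OF V W _ x y] U by (simp add: linear_isometric_embedding_def)
  then show ?thesis
    using linear_isometric_embeddingD(1)[OF U] x y
      linear_isometric_embeddingD(4)[OF U seminormed_space.minus_mem[OF V x y]]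
    by (simp add: vdist_def)
qed

lemma normed_space_transport:
  assumes W: "normed_space K W"
    and bij: "bij_betw f (carrier W) (carrier V)"
    and add: "\<And>x y. x \<in> carrier W \<Longrightarrow> y \<in> carrier W \<Longrightarrow> f (x \<oplus>\<^bsub>W\<^esub> y) = f x \<oplus>\<^bsub>V\<^esub> f y"
    and zero: "f \<zero>\<^bsub>W\<^esub> = \<zero>\<^bsub>V\<^esub>"
    and smult: "\<And>a x. a \<in> K \<Longrightarrow> x \<in> carrier W \<Longrightarrow> f (a \<odot>\<^bsub>W\<^esub> x) = a \<odot>\<^bsub>V\<^esub> f x"
    and norm: "\<And>x. x \<in> carrier W \<Longrightarrow> vnorm V (f x) = vnorm W x"
  shows "normed_space K V"
proof -
  interpret W: normed_space K W by (rule W)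
  have img: "carrier V = f ` carrier W"
    using bij by (simp add: bij_betw_def)
  have f_mem: "f x \<in> carrier V" if "x \<in> carrier W" for x
    using img that by blast
  have "abelian_group V"
  proof (rule abelian_groupI)
    show "\<zero>\<^bsub>V\<^esub> \<in> carrier V"
      using f_mem[of "\<zero>\<^bsub>W\<^esub>"] by (simp add: zero)
    show "x \<oplus>\<^bsub>V\<^esub> y \<in> carrier V" if "x \<in> carrier V" "y \<in> carrier V" for x y
    proof -
      obtain u v where "u \<in> carrier W" "v \<in> carrier W" "x = f u" "y = f v"
        using \<open>x \<in> carrier V\<close> \<open>y \<in> carrier V\<close> unfolding img by blast
      then show ?thesis
        using f_mem[of "u \<oplus>\<^bsub>W\<^esub> v"] by (simp add: add)
    qed
    show "x \<oplus>\<^bsub>V\<^esub> y \<oplus>\<^bsub>V\<^esub> z = x \<oplus>\<^bsub>V\<^esub> (y \<oplus>\<^bsub>V\<^esub> z)"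
      if "x \<in> carrier V" "y \<in> carrier V" "z \<in> carrier V" for x y z
    proof -
      obtain u v w where "u \<in> carrier W" "v \<in> carrier W" "w \<in> carrier W" "x = f u" "y = f v" "z = f w"
        using \<open>x \<in> carrier V\<close> \<open>y \<in> carrier V\<close> \<open>z \<in> carrier V\<close> unfolding img by blast
      then show ?thesis
        using W.M.a_assoc[of u v w] by (simp flip: add)
    qed
    show "x \<oplus>\<^bsub>V\<^esub> y = y \<oplus>\<^bsub>V\<^esub> x" if "x \<in> carrier V" "y \<in> carrier V" for x y
    proof -
      obtain u v where "u \<in> carrier W" "v \<in> carrier W" "x = f u" "y = f v"
        using \<open>x \<in> carrier V\<close> \<open>y \<in> carrier V\<close> unfolding img by blast
      then show ?thesis
        using W.M.a_comm[of u v] by (simp flip: add)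
    qed
    show "\<zero>\<^bsub>V\<^esub> \<oplus>\<^bsub>V\<^esub> x = x" if "x \<in> carrier V" for x
    proof -
      obtain u where "u \<in> carrier W" "x = f u"
        using \<open>x \<in> carrier V\<close> unfolding img by blast
      then show ?thesis
        using add[of "\<zero>\<^bsub>W\<^esub>" u] by (simp add: zero)
    qed
    show "\<exists>y\<in>carrier V. y \<oplus>\<^bsub>V\<^esub> x = \<zero>\<^bsub>V\<^esub>" if "x \<in> carrier V" for x
    proof -
      obtain w where w: "w \<in> carrier W" "x = f w"
        using \<open>x \<in> carrier V\<close> unfolding img by blast
      then have "f (\<ominus>\<^bsub>W\<^esub> w) \<oplus>\<^bsub>V\<^esub> x = \<zero>\<^bsub>V\<^esub>"
        using add[of "\<ominus>\<^bsub>W\<^esub> w" w] by (simp add: W.M.l_neg zero)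
      then show ?thesis
        using f_mem[of "\<ominus>\<^bsub>W\<^esub> w"] w(1) by auto
    qed
  qed
  then have "Module.module (scalar_ring K) V"
  proof (rule moduleI[rotated])
    show "cring (scalar_ring K)" by unfold_locales
    fix x assume "x \<in> carrier V"
    then obtain v where v: "v \<in> carrier W" "x = f v"
      unfolding img by blast
    show "\<one>\<^bsub>scalar_ring K\<^esub> \<odot>\<^bsub>V\<^esub> x = x"
      using v smult[OF W.scalar_mem(2) v(1)] by (simp add: W.smult_scalar_one)
    fix a assume "a \<in> carrier (scalar_ring K)"
    then have a: "a \<in> K" by simp
    show "a \<odot>\<^bsub>V\<^esub> x \<in> carrier V"
      using f_mem[OF W.smult_mem[OF a v(1)]] v a by (simp add: smult)
    show "a \<odot>\<^bsub>V\<^esub> (x \<oplus>\<^bsub>V\<^esub> y) = a \<odot>\<^bsub>V\<^esub> x \<oplus>\<^bsub>V\<^esub> a \<odot>\<^bsub>V\<^esub> y" if "y \<in> carrier V" for y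
    proof -
      obtain w where "w \<in> carrier W" "y = f w"
        using \<open>y \<in> carrier V\<close> unfolding img by blast
      then show ?thesis
        using v a W.smult_r_distr[of a v w] by (auto simp flip: smult add simp: W.smult_mem)
    qed
    fix b assume "b \<in> carrier (scalar_ring K)"
    then have b: "b \<in> K" by simp
    show "(a \<oplus>\<^bsub>scalar_ring K\<^esub> b) \<odot>\<^bsub>V\<^esub> x = a \<odot>\<^bsub>V\<^esub> x \<oplus>\<^bsub>V\<^esub> b \<odot>\<^bsub>V\<^esub> x"
      using v a b W.smult_l_distr[of a b v] W.scalar_mem
      by (auto simp flip: smult add simp: W.smult_mem)
    show "(a \<otimes>\<^bsub>scalar_ring K\<^esub> b) \<odot>\<^bsub>V\<^esub> x = a \<odot>\<^bsub>V\<^esub> (b \<odot>\<^bsub>V\<^esub> x)"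
      using v a b W.smult_assoc1[of a b v] W.scalar_mem
      by (auto simp flip: smult simp: W.smult_mem)
  qed
  then show ?thesis
  proof (intro normed_space.intro seminormed_space.intro)
    show "seminormed_space_axioms K V"
    proof
      fix a x y assume "x \<in> carrier V"
      then obtain v where v: "v \<in> carrier W" "x = f v"
        unfolding img by blast
      show "0 \<le> vnorm V x"
        using v by (simp add: norm W.vnorm_nonneg)
      show "vnorm V (a \<odot>\<^bsub>V\<^esub> x) = cmod a * vnorm V x" if "a \<in> K"
        using v that by (simp add: norm W.vnorm_smult W.smult_mem flip: smult)
      assume "y \<in> carrier V"
      then obtain w where w: "w \<in> carrier W" "y = f w"
        unfolding img by blast
      show "vnorm V (x \<oplus>\<^bsub>V\<^esub> y) \<le> vnorm V x + vnorm V y"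
        using v w W.vnorm_triangle[of v w] by (simp add: norm flip: add)
    qed
    show "normed_space_axioms V"
    proof
      fix x assume "x \<in> carrier V" "vnorm V x = 0"
      then obtain v where v: "v \<in> carrier W" "x = f v"
        unfolding img by blast
      with \<open>vnorm V x = 0\<close> have "v = \<zero>\<^bsub>W\<^esub>"
        by (intro W.vnorm_definite) (simp_all add: norm)
      with v(2) show "x = \<zero>\<^bsub>V\<^esub>"
        by (simp only: zero)
    qed
  qed
qed

text \<open>A bijection respecting all operations carries completeness along. The lemma is used
  for the bijection from a subspace of a Banach space to a space of functions, and for the one from a
  normed space to its null quotient.\<close>

lemma banach_space_transport:
  assumes W: "banach_space K W"
    and bij: "bij_betw f (carrier W) (carrier V)"
    and add: "\<And>x y. x \<in> carrier W \<Longrightarrow> y \<in> carrier W \<Longrightarrow> f (x \<oplus>\<^bsub>W\<^esub> y) = f x \<oplus>\<^bsub>V\<^esub> f y"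
    and zero: "f \<zero>\<^bsub>W\<^esub> = \<zero>\<^bsub>V\<^esub>"
    and smult: "\<And>a x. a \<in> K \<Longrightarrow> x \<in> carrier W \<Longrightarrow> f (a \<odot>\<^bsub>W\<^esub> x) = a \<odot>\<^bsub>V\<^esub> f x"
    and norm: "\<And>x. x \<in> carrier W \<Longrightarrow> vnorm V (f x) = vnorm W x"
  shows "banach_space K V"
proof -
  have V: "normed_space K V"
    using W assms(2-) by (intro normed_space_transport[of K W f]) (auto simp: banach_space_def)
  interpret W: normed_space K W
    using W by (simp add: banach_space_def)
  interpret V: normed_space K V by (rule V)
  interpret MW: Metric_space "carrier W" "vdist W" by (rule W.Metric_space_vdist)
  interpret MV: Metric_space "carrier V" "vdist V" by (rule V.Metric_space_vdist)
  have img: "carrier V = f ` carrier W"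
    using bij by (simp add: bij_betw_def)
  have "linear_isometric_embedding K W V f"
    unfolding linear_isometric_embedding_def
    using img add smult norm by (auto intro!: linear_mapI)
  then have dist: "vdist V (f x) (f y) = vdist W x y" if "x \<in> carrier W" "y \<in> carrier W" for x y
    using that by (intro linear_isometry_vdist[of K]) unfold_locales
  have "\<exists>x. limitin MV.mtopology \<sigma> x sequentially" if \<sigma>: "MV.MCauchy \<sigma>" for \<sigma>
  proof -
    have "\<sigma> n \<in> f ` carrier W" for n
      using \<sigma> unfolding MV.MCauchy_def unfolding img by blast
    then have "\<forall>n. \<exists>w. w \<in> carrier W \<and> \<sigma> n = f w"
      by blast
    then obtain \<tau> where \<tau>: "\<And>n. \<tau> n \<in> carrier W" "\<And>n. \<sigma> n = f (\<tau> n)"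
      by metis
    then have "MW.MCauchy \<tau>"
      using \<sigma> unfolding MV.MCauchy_def MW.MCauchy_def by (auto simp: dist)
    then obtain w where "limitin MW.mtopology \<tau> w sequentially"
      using W unfolding banach_space_def MW.mcomplete_def by blast
    then have "limitin MV.mtopology \<sigma> (f w) sequentially"
      unfolding MW.limit_metric_sequentially MV.limit_metric_sequentially
      using \<tau> img by (auto simp: dist)
    then show ?thesis by blast
  qed
  then show ?thesis
    using V by (simp add: banach_space_def MV.mcomplete_def)
qed


section \<open>Closed subspaces\<close>

lemma submodule_minus:
  assumes V: "seminormed_space K V" and S: "submodule S (scalar_ring K) V"
    and "x \<in> S" "y \<in> S"
  shows "x \<ominus>\<^bsub>V\<lparr>carrier := S\<rparr>\<^esub> y = x \<ominus>\<^bsub>V\<^esub> y"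
proof -
  interpret V: seminormed_space K V by (rule V)
  have "inv\<^bsub>(add_monoid V)\<lparr>carrier := S\<rparr>\<^esub> y = inv\<^bsub>add_monoid V\<^esub> y"
    by (rule group.m_inv_consistent[OF V.a_group submodule.axioms(1)[OF S] \<open>y \<in> S\<close>])
  then show ?thesis
    by (simp add: a_minus_def a_inv_def)
qed

lemma normed_space_submodule:
  assumes V: "normed_space K V" and S: "submodule S (scalar_ring K) V"
  shows "normed_space K (V\<lparr>carrier := S\<rparr>)"
proof -
  interpret V: normed_space K V by (rule V)
  have sub: "x \<in> carrier V" if "x \<in> S" for x
    using V.submoduleE(1)[OF S] that by blast
  show ?thesis
  proof (intro normed_space.intro seminormed_space.intro)
    show "Module.module (scalar_ring K) (V\<lparr>carrier := S\<rparr>)"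
      by (rule submodule.submodule_is_module[OF S]) unfold_locales
    show "seminormed_space_axioms K (V\<lparr>carrier := S\<rparr>)"
      by unfold_locales (auto simp: sub V.vnorm_nonneg V.vnorm_triangle V.vnorm_smult)
    show "normed_space_axioms (V\<lparr>carrier := S\<rparr>)"
      by unfold_locales (auto simp: sub V.vnorm_definite)
  qed
qed

lemma vdist_submodule:
  assumes "seminormed_space K V" "submodule S (scalar_ring K) V" "x \<in> S" "y \<in> S"
  shows "vdist (V\<lparr>carrier := S\<rparr>) x y = vdist V x y"
  using assms submodule_minus[OF assms] module.submoduleE(1)[OF seminormed_space.axioms(1) assms(2)]
  by (auto simp: vdist_def)

lemma banach_space_closed_subspace:
  assumes V: "banach_space K V" and S: "closed_subspace K S V"
  shows "banach_space K (V\<lparr>carrier := S\<rparr>)"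
proof -
  interpret V: normed_space K V
    using V by (simp add: banach_space_def)
  have sub: "submodule S (scalar_ring K) V"
    using S by (simp add: closed_subspace_def)
  have W: "normed_space K (V\<lparr>carrier := S\<rparr>)"
    by (rule normed_space_submodule[OF _ sub]) unfold_locales
  interpret W: normed_space K "V\<lparr>carrier := S\<rparr>" by (rule W)
  interpret MV: Metric_space "carrier V" "vdist V" by (rule V.Metric_space_vdist)
  interpret MW: Metric_space "carrier (V\<lparr>carrier := S\<rparr>)" "vdist (V\<lparr>carrier := S\<rparr>)"
    by (rule W.Metric_space_vdist)
  have dist: "vdist (V\<lparr>carrier := S\<rparr>) x y = vdist V x y" if "x \<in> S" "y \<in> S" for x y
    by (rule vdist_submodule[OF _ sub that]) unfold_locales
  have "\<exists>x. limitin MW.mtopology \<sigma> x sequentially" if \<sigma>: "MW.MCauchy \<sigma>" for \<sigma>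
  proof -
    have mem: "\<sigma> n \<in> S" for n
      using \<sigma> unfolding MW.MCauchy_def by auto
    then have "MV.MCauchy \<sigma>"
      using \<sigma> V.submoduleE(1)[OF sub] unfolding MW.MCauchy_def MV.MCauchy_def by (auto simp: dist)
    then obtain x where x: "limitin MV.mtopology \<sigma> x sequentially"
      using V unfolding banach_space_def MV.mcomplete_def by blast
    then have "x \<in> S"
      using S mem unfolding closed_subspace_def MV.metric_closedin_iff_sequentially_closed by blast
    then have "limitin MW.mtopology \<sigma> x sequentially"
      using x mem unfolding MW.limit_metric_sequentially MV.limit_metric_sequentially
      by (simp add: dist) blast
    then show ?thesis by blast
  qed
  then show ?thesis
    using W MW.mcomplete_def by (simp add: banach_space_def)
qed

lemma closed_subspaceI:
  assumes V: "normed_space K V" and S: "submodule S (scalar_ring K) V"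
    and closed: "\<And>x. x \<in> carrier V \<Longrightarrow> (\<And>e. e > 0 \<Longrightarrow> \<exists>y\<in>S. vdist V x y < e) \<Longrightarrow> x \<in> S"
  shows "closed_subspace K S V"
proof -
  interpret V: normed_space K V by (rule V)
  interpret Metric_space "carrier V" "vdist V" by (rule V.Metric_space_vdist)
  have "closedin mtopology S"
    unfolding closedin_metric
  proof (intro conjI allI impI)
    show "S \<subseteq> carrier V"
      by (rule V.submoduleE(1)[OF S])
    fix x assume "x \<in> carrier V - S"
    then obtain e where "e > 0" "\<forall>y\<in>S. \<not> vdist V x y < e"
      using closed by blast
    then show "\<exists>r>0. disjnt S (mball x r)"
      by (auto simp: disjnt_def)
  qed
  with S show ?thesis
    by (simp add: closed_subspace_def)
qed


section \<open>Null quotients\<close>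

context seminormed_space
begin

abbreviation null_coset :: "'v \<Rightarrow> 'v set" where
  "null_coset x \<equiv> null_subspace V +> x"

lemma carrier_null_quotient: "carrier (null_quotient V) = null_coset ` carrier V"
  by (auto simp: null_quotient_def A_RCOSETS_def')

lemma null_coset_mem: "x \<in> carrier V \<Longrightarrow> null_coset x \<in> carrier (null_quotient V)"
  by (simp add: carrier_null_quotient)

lemma mem_null_coset_iff:
  assumes x: "x \<in> carrier V"
  shows "y \<in> null_coset x \<longleftrightarrow> y \<in> carrier V \<and> vnorm V (y \<ominus> x) = 0"
proof
  assume "y \<in> null_coset x"
  then obtain n where n: "n \<in> carrier V" "vnorm V n = 0" and y: "y = n \<oplus> x"
    unfolding a_r_coset_def' null_subspace_def by blast
  have "y \<ominus> x = n"
    using n x y by (simp add: M.minus_eq M.a_assoc M.r_neg)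
  with n x y show "y \<in> carrier V \<and> vnorm V (y \<ominus> x) = 0" by simp
next
  assume "y \<in> carrier V \<and> vnorm V (y \<ominus> x) = 0"
  then have "y \<ominus> x \<in> null_subspace V" "y = (y \<ominus> x) \<oplus> x"
    using x by (auto simp: null_subspace_def minus_mem minus_add_cancel)
  then show "y \<in> null_coset x"
    unfolding a_r_coset_def' by blast
qed

lemma null_coset_eq_iff:
  assumes x: "x \<in> carrier V" and y: "y \<in> carrier V"
  shows "null_coset x = null_coset y \<longleftrightarrow> vnorm V (x \<ominus> y) = 0"
proof
  assume "null_coset x = null_coset y"
  moreover have "x \<in> null_coset x"
    using x by (simp add: mem_null_coset_iff minus_self vnorm_zero)
  ultimately show "vnorm V (x \<ominus> y) = 0"
    using y by (simp add: mem_null_coset_iff)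
next
  assume "vnorm V (x \<ominus> y) = 0"
  then have "x \<in> null_coset y"
    using x y by (simp add: mem_null_coset_iff)
  interpret N: abelian_subgroup "null_subspace V" V
    by (rule abelian_subgroup_null_subspace)
  show "null_coset x = null_coset y"
    using N.a_repr_independence'[OF \<open>x \<in> null_coset y\<close> y] by simp
qed

lemma zero_null_quotient: "null_coset \<zero> = \<zero>\<^bsub>null_quotient V\<^esub>"
proof -
  have "null_coset \<zero> = null_subspace V"
    using mem_null_coset_iff[of \<zero>] by (auto simp: null_subspace_def minus_zero_right)
  then show ?thesis by (simp add: null_quotient_def)
qed

lemma null_coset_linear_isometry: "linear_isometric_embedding K V (null_quotient V) null_coset"
  unfolding linear_isometric_embedding_def
  by (auto intro!: linear_mapI
      simp: null_coset_mem vnorm_null_quotient add_null_quotient smult_null_quotient)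

end

lemma (in normed_space) bij_null_coset:
  "bij_betw null_coset (carrier V) (carrier (null_quotient V))"
  unfolding bij_betw_def carrier_null_quotient
proof (intro conjI refl inj_onI)
  fix x y assume xy: "x \<in> carrier V" "y \<in> carrier V" and "null_coset x = null_coset y"
  then have "x \<ominus> y = \<zero>"
    by (intro vnorm_definite) (simp_all add: null_coset_eq_iff minus_mem)
  then show "x = y"
    using minus_add_cancel[OF xy] xy by simp
qed

lemma banach_space_null_quotient:
  assumes "banach_space K V"
  shows "banach_space K (null_quotient V)"
proof -
  interpret normed_space K V
    using assms by (simp add: banach_space_def)
  show ?thesis
    by (rule banach_space_transport[OF assms bij_null_coset])
      (simp_all add: vnorm_null_quotient add_null_quotient smult_null_quotient zero_null_quotient)
qed

text \<open>An isometry maps the null subspace into itself and hence acts on cosets.\<close>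

lemma induced_isometry_null_quotient:
  assumes V: "seminormed_space K V" and U: "linear_isometric_embedding K V V U"
  obtains U' where "linear_isometric_embedding K (null_quotient V) (null_quotient V) U'"
    and "\<And>x. x \<in> carrier V \<Longrightarrow>
      U' (null_subspace V +>\<^bsub>V\<^esub> x) = null_subspace V +>\<^bsub>V\<^esub> U x"
proof -
  interpret seminormed_space K V by (rule V)
  note UD = linear_isometric_embeddingD[OF U]
  define r where "r A = (SOME x. x \<in> carrier V \<and> null_coset x = A)" for A
  \<comment> \<open>As \<open>U\<close> is isometric, the coset of \<open>U x\<close> does not depend on the representative \<open>x\<close>.\<close>
  define U' where "U' A = null_coset (U (r A))" for A
  have U': "U' (null_coset x) = null_coset (U x)" if x: "x \<in> carrier V" for x
  proof -
    let ?r = "r (null_coset x)"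
    have r: "?r \<in> carrier V" "null_coset ?r = null_coset x"
      using someI[of "\<lambda>y. y \<in> carrier V \<and> null_coset y = null_coset x" x] x by (auto simp: r_def)
    then have "vdist V (U ?r) (U x) = 0"
      using x linear_isometry_vdist[OF V V U r(1) x] by (simp add: vdist_eq null_coset_eq_iff)
    then show ?thesis
      using r x UD(1) by (simp add: U'_def null_coset_eq_iff vdist_eq)
  qed
  have rep: "\<exists>x. x \<in> carrier V \<and> A = null_coset x" if "A \<in> carrier (null_quotient V)" for A
    using that unfolding carrier_null_quotient by blast
  have "linear_isometric_embedding K (null_quotient V) (null_quotient V) U'"
    unfolding linear_isometric_embedding_def
  proof (intro conjI ballI linear_mapI)
    fix A assume "A \<in> carrier (null_quotient V)"
    then obtain x where x: "x \<in> carrier V" "A = null_coset x"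
      using rep by blast
    show "U' A \<in> carrier (null_quotient V)" "vnorm (null_quotient V) (U' A) = vnorm (null_quotient V) A"
      using x UD(1,4) by (simp_all add: U' null_coset_mem vnorm_null_quotient)
    show "U' (a \<odot>\<^bsub>null_quotient V\<^esub> A) = a \<odot>\<^bsub>null_quotient V\<^esub> U' A" if "a \<in> K" for a
      using that x UD(1,3) by (simp add: U' smult_null_quotient smult_mem)
    fix B assume "B \<in> carrier (null_quotient V)"
    then obtain y where y: "y \<in> carrier V" "B = null_coset y"
      using rep by blast
    show "U' (A \<oplus>\<^bsub>null_quotient V\<^esub> B) = U' A \<oplus>\<^bsub>null_quotient V\<^esub> U' B"
      using x y UD(1,2) by (simp add: U' add_null_quotient)
  qed
  with U' show thesis by (intro that)
qed


section \<open>Continuity into pseudometric spaces\<close>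

lemma topspace_pseudometric_topology: "topspace (pseudometric_topology X d) = X"
proof -
  have "openin (pseudometric_topology X d) X"
    unfolding openin_pseudometric_topology by (auto intro!: exI[of _ 1])
  then show ?thesis
    using openin_subset[of "pseudometric_topology X d"] openin_topspace[of "pseudometric_topology X d"]
    unfolding openin_pseudometric_topology by blast
qed

lemma continuous_map_pseudometric_iff:
  assumes self: "\<And>x. x \<in> X \<Longrightarrow> d x x = 0"
    and triangle: "\<And>x y z. x \<in> X \<Longrightarrow> y \<in> X \<Longrightarrow> z \<in> X \<Longrightarrow> d x z \<le> d x y + d y z"
  shows "continuous_map T (pseudometric_topology X d) f \<longleftrightarrow>
    f \<in> topspace T \<rightarrow> X \<and>
    (\<forall>t\<in>topspace T. \<forall>e>0. \<exists>W. openin T W \<and> t \<in> W \<and> (\<forall>s\<in>W. d (f t) (f s) < e))"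
    (is "?lhs \<longleftrightarrow> ?rhs")
proof
  assume L: ?lhs
  then have f: "f \<in> topspace T \<rightarrow> X"
    using continuous_map_funspace topspace_pseudometric_topology by metis
  moreover have "\<exists>W. openin T W \<and> t \<in> W \<and> (\<forall>s\<in>W. d (f t) (f s) < e)"
    if t: "t \<in> topspace T" and e: "e > 0" for t e
  proof -
    let ?U = "{y \<in> X. d (f t) y < e}"
    have ft: "f t \<in> X" using f t by auto
    have "openin (pseudometric_topology X d) ?U"
      unfolding openin_pseudometric_topology
    proof (intro conjI ballI)
      fix y assume y: "y \<in> ?U"
      have "{z \<in> X. d y z < e - d (f t) y} \<subseteq> ?U"
        using triangle[OF ft, of y] y by fastforce
      then show "\<exists>r>0. {z \<in> X. d y z < r} \<subseteq> ?U"
        using y by (intro exI[of _ "e - d (f t) y"]) auto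
    qed auto
    then have "openin T {s \<in> topspace T. f s \<in> ?U}"
      by (rule openin_continuous_map_preimage[OF L])
    then show ?thesis
      using t ft self[OF ft] e by (intro exI[of _ "{s \<in> topspace T. f s \<in> ?U}"]) auto
  qed
  ultimately show ?rhs by blast
next
  assume R: ?rhs
  show ?lhs
    unfolding continuous_map_def topspace_pseudometric_topology
  proof (intro conjI allI impI)
    fix U assume U: "openin (pseudometric_topology X d) U"
    show "openin T {t \<in> topspace T. f t \<in> U}"
    proof (subst openin_subopen, intro ballI)
      fix t assume t: "t \<in> {t \<in> topspace T. f t \<in> U}"
      with U obtain r where r: "r > 0" "{y \<in> X. d (f t) y < r} \<subseteq> U"
        unfolding openin_pseudometric_topology by blast
      with R t obtain W where W: "openin T W" "t \<in> W" "\<forall>s\<in>W. d (f t) (f s) < r"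
        by blast
      moreover have "W \<subseteq> {t \<in> topspace T. f t \<in> U}"
        using W r R openin_subset[OF W(1)] by blast
      ultimately show "\<exists>W. openin T W \<and> t \<in> W \<and> W \<subseteq> {t \<in> topspace T. f t \<in> U}"
        by blast
    qed
  qed (use R in blast)
qed



section \<open>Labelled partitions pulled back from a Banach space\<close>

lemma bounded_functionalD:
  assumes "bounded_functional K V l"
  shows "x \<in> carrier V \<Longrightarrow> l x \<in> K"
    and "x \<in> carrier V \<Longrightarrow> y \<in> carrier V \<Longrightarrow> l (x \<oplus>\<^bsub>V\<^esub> y) = l x + l y"
    and "a \<in> K \<Longrightarrow> x \<in> carrier V \<Longrightarrow> l (a \<odot>\<^bsub>V\<^esub> x) = a * l x"
  using assms unfolding bounded_functional_def by blast+

lemma bounded_functional_bound: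
  assumes "bounded_functional K V l" and V: "seminormed_space K V"
  obtains C where "C > 0" "\<And>x. x \<in> carrier V \<Longrightarrow> cmod (l x) \<le> C * vnorm V x"
proof -
  obtain C where C: "\<And>x. x \<in> carrier V \<Longrightarrow> cmod (l x) \<le> C * vnorm V x"
    using assms unfolding bounded_functional_def by blast
  have "cmod (l x) \<le> (\<bar>C\<bar> + 1) * vnorm V x" if "x \<in> carrier V" for x
  proof -
    have "C * vnorm V x \<le> (\<bar>C\<bar> + 1) * vnorm V x"
      using seminormed_space.vnorm_nonneg[OF V that] by (intro mult_right_mono) auto
    with C[OF that] show ?thesis by linarith
  qed
  then show thesis by (intro that[of "\<bar>C\<bar> + 1"]) auto
qed

lemma bounded_functional_minus:
  assumes V: "seminormed_space K V" and l: "bounded_functional K V l"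
    and x: "x \<in> carrier V" and y: "y \<in> carrier V"
  shows "l (x \<ominus>\<^bsub>V\<^esub> y) = l x - l y"
  using bounded_functionalD(2)[OF l seminormed_space.minus_mem[OF V x y] y]
    seminormed_space.minus_add_cancel[OF V x y] by simp

lemma bounded_functional_diff:
  assumes V: "seminormed_space K V" and l: "bounded_functional K V l" and m: "bounded_functional K V m"
  shows "bounded_functional K V (\<lambda>x. l x - m x)"
proof -
  interpret seminormed_space K V by (rule V)
  have K_diff: "a - b \<in> K" if "a \<in> K" "b \<in> K" for a b
    using scalar_mem(3)[OF that(1) scalar_uminus(2)[OF that(2)]] by simp
  obtain C where C: "\<And>x. x \<in> carrier V \<Longrightarrow> cmod (l x) \<le> C * vnorm V x"
    using bounded_functional_bound[OF l V] by blast
  obtain D where D: "\<And>x. x \<in> carrier V \<Longrightarrow> cmod (m x) \<le> D * vnorm V x"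
    using bounded_functional_bound[OF m V] by blast
  have "cmod (l x - m x) \<le> (C + D) * vnorm V x" if "x \<in> carrier V" for x
    using norm_triangle_ineq4[of "l x" "m x"] C[OF that] D[OF that] by (simp add: algebra_simps)
  then show ?thesis
    unfolding bounded_functional_def
    using bounded_functionalD[OF l] bounded_functionalD[OF m]
    by (intro conjI exI[of _ "C + D"]) (auto simp: K_diff algebra_simps)
qed

lemma bounded_functional_compose_isometry:
  assumes l: "bounded_functional K W l" and U: "linear_isometric_embedding K V W U"
  shows "bounded_functional K V (\<lambda>x. l (U x))"
proof -
  obtain C where "\<forall>x\<in>carrier W. cmod (l x) \<le> C * vnorm W x"
    using l unfolding bounded_functional_def by blast
  then have "\<forall>x\<in>carrier V. cmod (l (U x)) \<le> C * vnorm V x"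
    using linear_isometric_embeddingD(1,4)[OF U] by fastforce
  then show ?thesis
    unfolding bounded_functional_def
    using bounded_functionalD[OF l] linear_isometric_embeddingD[OF U] by auto
qed

text \<open>The structure lives on an arbitrary set \<open>X\<close> mapped into \<open>B\<close> by \<open>b\<close>; for a group acting on \<open>B\<close>, the map
  \<open>b\<close> is an orbit map. The constants \<open>a\<close> in the labels make room for the translation parts
  of affine maps of \<open>B\<close>.\<close>

locale labelled_pullback =
  fixes K :: "complex set" and B :: "('v, 'z) normed_module_scheme"
    and X :: "'x set" and b :: "'x \<Rightarrow> 'v"
  assumes K: "K = \<real> \<or> K = UNIV"
    and banach: "banach_space K B"
    and b_mem: "x \<in> X \<Longrightarrow> b x \<in> carrier B"
begin

sublocale B: normed_space K B
  using banach by (simp add: banach_space_def)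

definition label :: "('v \<Rightarrow> complex) \<Rightarrow> complex \<Rightarrow> 'x \<Rightarrow> complex" where
  "label l a = (\<lambda>x\<in>X. l (b x) + a)"

definition labels :: "('x \<Rightarrow> complex) set" where
  "labels = {label l a | l a. bounded_functional K B l \<and> a \<in> K}"

text \<open>By the Hahn--Banach theorem this is the closed linear span of the differences \<open>b x - b y\<close>;
  defined as a common kernel it is closed and stable under isometries for formal reasons.\<close>

definition difference_span :: "'v set" where
  "difference_span = {v \<in> carrier B. \<forall>l. bounded_functional K B l \<longrightarrow>
     (\<forall>x\<in>X. \<forall>y\<in>X. l (b x) = l (b y)) \<longrightarrow> l v = 0}"

text \<open>A label does not determine its functional \<open>l\<close>, so one is chosen; on vectors of
  \<open>difference_span\<close> the choice has no effect.\<close>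

definition evaluation :: "'v \<Rightarrow> ('x \<Rightarrow> complex) \<Rightarrow> complex" where
  "evaluation v = (\<lambda>p\<in>labels. (SOME l. bounded_functional K B l \<and> (\<exists>a\<in>K. p = label l a)) v)"

definition function_space :: "(('x \<Rightarrow> complex) \<Rightarrow> complex) normed_module" where
  "function_space =
     \<lparr>carrier = evaluation ` difference_span,
      mult = undefined,
      one = undefined,
      zero = (\<lambda>p\<in>labels. 0),
      add = (\<lambda>\<xi> \<eta>. \<lambda>p\<in>labels. \<xi> p + \<eta> p),
      smult = (\<lambda>a \<xi>. \<lambda>p\<in>labels. a * \<xi> p),
      vnorm = (\<lambda>\<xi>. vnorm B (inv_into difference_span evaluation \<xi>))\<rparr>"

lemma label_mem: "bounded_functional K B l \<Longrightarrow> a \<in> K \<Longrightarrow> label l a \<in> labels"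
  unfolding labels_def by blast

lemma labelsE:
  assumes "p \<in> labels"
  obtains l a where "bounded_functional K B l" "a \<in> K" "p = label l a"
  using assms unfolding labels_def by blast

lemma difference_span_subset: "v \<in> difference_span \<Longrightarrow> v \<in> carrier B"
  by (simp add: difference_span_def)

lemma difference_spanI:
  assumes "v \<in> carrier B"
    and "\<And>l. bounded_functional K B l \<Longrightarrow> (\<And>x y. x \<in> X \<Longrightarrow> y \<in> X \<Longrightarrow> l (b x) = l (b y)) \<Longrightarrow> l v = 0"
  shows "v \<in> difference_span"
  using assms unfolding difference_span_def by blast

lemma difference_spanD:
  "v \<in> difference_span \<Longrightarrow> bounded_functional K B l \<Longrightarrow>
    (\<And>x y. x \<in> X \<Longrightarrow> y \<in> X \<Longrightarrow> l (b x) = l (b y)) \<Longrightarrow> l v = 0"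
  unfolding difference_span_def by blast

text \<open>Two functionals giving the same label up to a constant differ by a functional that is constant on the
  range of \<open>b\<close>, and such functionals vanish on \<open>difference_span\<close>.\<close>

lemma evaluation_label:
  assumes v: "v \<in> difference_span" and l: "bounded_functional K B l" and a: "a \<in> K"
  shows "evaluation v (label l a) = l v"
proof -
  define m where "m = (SOME m. bounded_functional K B m \<and> (\<exists>c\<in>K. label l a = label m c))"
  have "\<exists>m. bounded_functional K B m \<and> (\<exists>c\<in>K. label l a = label m c)"
    using l a by blast
  then have "bounded_functional K B m \<and> (\<exists>c\<in>K. label l a = label m c)"
    unfolding m_def by (rule someI_ex)
  then obtain c where m: "bounded_functional K B m" and c: "label l a = label m c"
    by blast
  have const: "l (b x) - m (b x) = c - a" if "x \<in> X" for x
    using fun_cong[OF c, of x] that by (simp add: label_def algebra_simps)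
  have "l v - m v = 0"
    by (rule difference_spanD[OF v bounded_functional_diff[OF B.seminormed_space_axioms l m]])
      (simp only: const)
  moreover have "evaluation v (label l a) = m v"
    using label_mem[OF l a] by (simp only: evaluation_def m_def restrict_apply')
  ultimately show ?thesis by simp
qed

lemma evaluation_eqI:
  assumes "v \<in> difference_span" "\<xi> \<in> extensional labels"
    and "\<And>l a. bounded_functional K B l \<Longrightarrow> a \<in> K \<Longrightarrow> \<xi> (label l a) = l v"
  shows "\<xi> = evaluation v"
proof (rule extensionalityI[OF assms(2)])
  show "evaluation v \<in> extensional labels"
    by (simp add: evaluation_def)
  show "\<xi> p = evaluation v p" if "p \<in> labels" for p
    using that assms(3) evaluation_label[OF assms(1)] by (auto elim!: labelsE)
qed

text \<open>This is where the Hahn--Banach theorem enters: without injectivity the norm of \<open>B\<close> could not be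
  moved to the functions on labels.\<close>

lemma inj_on_evaluation: "inj_on evaluation difference_span"
proof (rule inj_onI, rule ccontr)
  fix v w assume v: "v \<in> difference_span" and w: "w \<in> difference_span"
    and eq: "evaluation v = evaluation w" and "v \<noteq> w"
  note vw = difference_span_subset[OF v] difference_span_subset[OF w]
  have "vnorm B (v \<ominus>\<^bsub>B\<^esub> w) \<noteq> 0"
  proof
    assume "vnorm B (v \<ominus>\<^bsub>B\<^esub> w) = 0"
    then have "v \<ominus>\<^bsub>B\<^esub> w = \<zero>\<^bsub>B\<^esub>"
      using vw by (intro B.vnorm_definite B.minus_mem)
    then show False
      using B.minus_add_cancel[OF vw] vw \<open>v \<noteq> w\<close> by simp
  qed
  then obtain l where l: "bounded_functional K B l" "l (v \<ominus>\<^bsub>B\<^esub> w) \<noteq> 0"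
    using bounded_functionals_separate_points[OF K B.seminormed_space_axioms B.minus_mem[OF vw]]
    by blast
  moreover have "l v = l w"
    using evaluation_label[OF v l(1) B.scalar_mem(1)] evaluation_label[OF w l(1) B.scalar_mem(1)] eq
    by simp
  ultimately show False
    using bounded_functional_minus[OF B.seminormed_space_axioms l(1) vw] by simp
qed

lemma difference_span_submodule: "submodule difference_span (scalar_ring K) B"
proof (rule B.submoduleI)
  note sn = B.seminormed_space_axioms
  have zero: "l \<zero>\<^bsub>B\<^esub> = 0" if "bounded_functional K B l" for l
    using bounded_functionalD(2)[OF that, of "\<zero>\<^bsub>B\<^esub>" "\<zero>\<^bsub>B\<^esub>"] by simp
  show "\<zero>\<^bsub>B\<^esub> \<in> difference_span"
    by (rule difference_spanI) (simp_all add: zero)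
  show "v \<oplus>\<^bsub>B\<^esub> w \<in> difference_span" if v: "v \<in> difference_span" and w: "w \<in> difference_span" for v w
  proof (rule difference_spanI)
    fix l assume l: "bounded_functional K B l" "\<And>x y. x \<in> X \<Longrightarrow> y \<in> X \<Longrightarrow> l (b x) = l (b y)"
    show "l (v \<oplus>\<^bsub>B\<^esub> w) = 0"
      using difference_spanD[OF v l] difference_spanD[OF w l]
        bounded_functionalD(2)[OF l(1) difference_span_subset[OF v] difference_span_subset[OF w]] by simp
  qed (simp add: v w difference_span_subset)
  show "a \<odot>\<^bsub>B\<^esub> v \<in> difference_span" if "a \<in> carrier (scalar_ring K)" and v: "v \<in> difference_span" for a v
  proof (rule difference_spanI)
    fix l assume l: "bounded_functional K B l" "\<And>x y. x \<in> X \<Longrightarrow> y \<in> X \<Longrightarrow> l (b x) = l (b y)"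
    show "l (a \<odot>\<^bsub>B\<^esub> v) = 0"
      using difference_spanD[OF v l] that(1)
        bounded_functionalD(3)[OF l(1) _ difference_span_subset[OF v], of a] by simp
  qed (use that in \<open>simp add: B.smult_mem difference_span_subset\<close>)
  show "\<ominus>\<^bsub>B\<^esub> v \<in> difference_span" if v: "v \<in> difference_span" for v
  proof (rule difference_spanI)
    fix l assume l: "bounded_functional K B l" "\<And>x y. x \<in> X \<Longrightarrow> y \<in> X \<Longrightarrow> l (b x) = l (b y)"
    show "l (\<ominus>\<^bsub>B\<^esub> v) = 0"
      using bounded_functional_minus[OF sn l(1), of "\<zero>\<^bsub>B\<^esub>" v] zero[OF l(1)] difference_spanD[OF v l]
        difference_span_subset[OF v]
      by (simp add: a_minus_def)
  qed (simp add: v difference_span_subset)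
qed (simp add: difference_span_def)

lemma difference_span_closed: "closed_subspace K difference_span B"
proof (rule closed_subspaceI[OF B.normed_space_axioms difference_span_submodule])
  fix v assume v: "v \<in> carrier B" and close: "\<And>e. e > 0 \<Longrightarrow> \<exists>w\<in>difference_span. vdist B v w < e"
  have "l v = 0"
    if l: "bounded_functional K B l" and const: "\<And>x y. x \<in> X \<Longrightarrow> y \<in> X \<Longrightarrow> l (b x) = l (b y)" for l
  proof (rule ccontr)
    assume "l v \<noteq> 0"
    obtain C where C: "C > 0" "\<And>x. x \<in> carrier B \<Longrightarrow> cmod (l x) \<le> C * vnorm B x"
      using bounded_functional_bound[OF l B.seminormed_space_axioms] by blast
    then obtain w where w: "w \<in> difference_span" "vdist B v w < cmod (l v) / C"
      using close[of "cmod (l v) / C"] \<open>l v \<noteq> 0\<close> by auto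
    have "l w = 0"
      by (rule difference_spanD[OF w(1) l const])
    then have "cmod (l v) = cmod (l (v \<ominus>\<^bsub>B\<^esub> w))"
      using bounded_functional_minus[OF B.seminormed_space_axioms l v difference_span_subset[OF w(1)]] by simp
    also have "\<dots> \<le> C * vdist B v w"
      using C(2) v difference_span_subset[OF w(1)] by (simp add: B.vdist_eq B.minus_mem)
    also have "\<dots> < cmod (l v)"
      using w(2) C(1) by (simp add: field_simps)
    finally show False by simp
  qed
  then show "v \<in> difference_span"
    using v unfolding difference_span_def by blast
qed

lemma evaluation_mem: "v \<in> difference_span \<Longrightarrow> evaluation v \<in> carrier function_space"
  by (simp add: function_space_def)

lemma evaluation_add:
  assumes v: "v \<in> difference_span" and w: "w \<in> difference_span"
  shows "evaluation (v \<oplus>\<^bsub>B\<^esub> w) = evaluation v \<oplus>\<^bsub>function_space\<^esub> evaluation w"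
proof (rule evaluation_eqI[symmetric])
  show "v \<oplus>\<^bsub>B\<^esub> w \<in> difference_span"
    using B.submoduleE(5)[OF difference_span_submodule v w] .
qed (simp_all add: function_space_def evaluation_label v w label_mem difference_span_subset
      bounded_functionalD(2))

lemma evaluation_smult:
  assumes a: "a \<in> K" and v: "v \<in> difference_span"
  shows "evaluation (a \<odot>\<^bsub>B\<^esub> v) = a \<odot>\<^bsub>function_space\<^esub> evaluation v"
proof (rule evaluation_eqI[symmetric])
  show "a \<odot>\<^bsub>B\<^esub> v \<in> difference_span"
    using B.submoduleE(4)[OF difference_span_submodule _ v] a by simp
qed (use a in \<open>simp_all add: function_space_def evaluation_label v label_mem difference_span_subset
      bounded_functionalD(3)\<close>)

lemma evaluation_zero: "evaluation \<zero>\<^bsub>B\<^esub> = \<zero>\<^bsub>function_space\<^esub>"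
proof (rule evaluation_eqI[symmetric])
  show "\<zero>\<^bsub>B\<^esub> \<in> difference_span"
    using submodule.axioms(1)[OF difference_span_submodule, THEN subgroup.one_closed] by simp
  show "\<zero>\<^bsub>function_space\<^esub> (label l a) = l \<zero>\<^bsub>B\<^esub>" if "bounded_functional K B l" "a \<in> K" for l a
    using that bounded_functionalD(2)[of K B l "\<zero>\<^bsub>B\<^esub>" "\<zero>\<^bsub>B\<^esub>"] by (simp add: function_space_def label_mem)
qed (simp add: function_space_def)

lemma vnorm_evaluation: "v \<in> difference_span \<Longrightarrow> vnorm function_space (evaluation v) = vnorm B v"
  by (simp add: function_space_def inj_on_evaluation)

lemma bij_evaluation: "bij_betw evaluation difference_span (carrier function_space)"
  using inj_on_evaluation by (simp add: bij_betw_def function_space_def)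

lemma banach_space_function_space: "banach_space K function_space"
proof (rule banach_space_transport[where f = evaluation])
  show "banach_space K (B\<lparr>carrier := difference_span\<rparr>)"
    by (rule banach_space_closed_subspace[OF banach difference_span_closed])
qed (simp_all add: bij_evaluation evaluation_add evaluation_smult evaluation_zero vnorm_evaluation)

lemma difference_mem:
  assumes "x \<in> X" "y \<in> X"
  shows "b x \<ominus>\<^bsub>B\<^esub> b y \<in> difference_span"
proof (rule difference_spanI)
  fix l assume l: "bounded_functional K B l" "\<And>x y. x \<in> X \<Longrightarrow> y \<in> X \<Longrightarrow> l (b x) = l (b y)"
  show "l (b x \<ominus>\<^bsub>B\<^esub> b y) = 0"
    using bounded_functional_minus[OF B.seminormed_space_axioms l(1) b_mem b_mem] assms l(2)[OF assms] by simp
qed (simp add: assms b_mem B.minus_mem)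

lemma separation_map_eq:
  assumes "x \<in> X" "y \<in> X"
  shows "separation_map labels x y = evaluation (b x \<ominus>\<^bsub>B\<^esub> b y)"
proof (rule evaluation_eqI[OF difference_mem[OF assms]])
  show "separation_map labels x y (label l a) = l (b x \<ominus>\<^bsub>B\<^esub> b y)"
    if "bounded_functional K B l" "a \<in> K" for l a
    using that assms bounded_functional_minus[OF B.seminormed_space_axioms that(1)]
    by (simp add: separation_map_def label_mem b_mem) (simp add: label_def)
qed (simp add: separation_map_def)

theorem labelled_partitions_space_pullback:
  "labelled_partitions_space K X labels function_space"
  unfolding labelled_partitions_space_def seminormed_function_space_def
proof (intro conjI ballI)
  show "labels \<subseteq> X \<rightarrow>\<^sub>E K"
    by (auto simp: label_def b_mem bounded_functionalD(1) B.scalar_mem(3) elim!: labelsE)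
  show "seminormed_space K function_space"
    using banach_space_function_space by (simp add: banach_space_def normed_space_def)
  show "carrier function_space \<subseteq> labels \<rightarrow>\<^sub>E K"
  proof
    fix \<xi> assume "\<xi> \<in> carrier function_space"
    then obtain v where v: "v \<in> difference_span" "\<xi> = evaluation v"
      by (auto simp: function_space_def)
    show "\<xi> \<in> labels \<rightarrow>\<^sub>E K"
    proof (rule PiE_I)
      show "\<xi> p \<in> K" if "p \<in> labels" for p
        using that v by (auto simp: evaluation_label bounded_functionalD(1) difference_span_subset elim!: labelsE)
      show "\<xi> p = undefined" if "p \<notin> labels" for p
        using that v by (simp add: evaluation_def)
    qed
  qed
  show "banach_space K (null_quotient function_space)"
    by (rule banach_space_null_quotient[OF banach_space_function_space])
  show "separation_map labels x y \<in> carrier function_space" if "x \<in> X" "y \<in> X" for x y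
    using that by (simp add: separation_map_eq evaluation_mem difference_mem)
qed (simp_all add: function_space_def)

lemma labelled_partitions_dist_pullback:
  "x \<in> X \<Longrightarrow> y \<in> X \<Longrightarrow> labelled_partitions_dist labels function_space x y = vdist B (b x) (b y)"
  by (simp add: labelled_partitions_dist_def separation_map_eq vnorm_evaluation difference_mem
      B.vdist_eq b_mem)

lemma null_quotient_embeds:
  "\<exists>J. linear_isometric_embedding K (null_quotient function_space) B J"
proof -
  interpret F: normed_space K function_space
    using banach_space_function_space by (simp add: banach_space_def)
  define h where "h v = F.null_coset (evaluation v)" for v
  define J where "J = inv_into difference_span h"
  have bij: "bij_betw h difference_span (carrier (null_quotient function_space))"
    using bij_betw_trans[OF bij_evaluation F.bij_null_coset] by (simp add: h_def[abs_def] comp_def)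
  have J: "J (h v) = v" if "v \<in> difference_span" for v
    unfolding J_def using bij that by (simp add: bij_betw_def)
  have rep: "\<exists>v. v \<in> difference_span \<and> A = h v" if "A \<in> carrier (null_quotient function_space)" for A
    using that bij unfolding bij_betw_def by blast
  have "linear_isometric_embedding K (null_quotient function_space) B J"
    unfolding linear_isometric_embedding_def
  proof (intro conjI ballI linear_mapI)
    fix A assume "A \<in> carrier (null_quotient function_space)"
    then obtain v where v: "v \<in> difference_span" "A = h v"
      using rep by blast
    show "J A \<in> carrier B"
      using v by (simp add: J difference_span_subset)
    show "vnorm B (J A) = vnorm (null_quotient function_space) A"
      using v by (simp add: J) (simp add: h_def F.vnorm_null_quotient evaluation_mem vnorm_evaluation)
    show "J (a \<odot>\<^bsub>null_quotient function_space\<^esub> A) = a \<odot>\<^bsub>B\<^esub> J A" if a: "a \<in> K" for a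
    proof -
      have av: "a \<odot>\<^bsub>B\<^esub> v \<in> difference_span"
        using B.submoduleE(4)[OF difference_span_submodule _ v(1)] a by simp
      have "a \<odot>\<^bsub>null_quotient function_space\<^esub> A = h (a \<odot>\<^bsub>B\<^esub> v)"
        using v a by (simp add: h_def F.smult_null_quotient evaluation_mem evaluation_smult)
      then show ?thesis
        using v av by (simp add: J)
    qed
    fix A' assume "A' \<in> carrier (null_quotient function_space)"
    then obtain w where w: "w \<in> difference_span" "A' = h w"
      using rep by blast
    have "A \<oplus>\<^bsub>null_quotient function_space\<^esub> A' = h (v \<oplus>\<^bsub>B\<^esub> w)"
      using v w by (simp add: h_def F.add_null_quotient evaluation_mem evaluation_add)
    then show "J (A \<oplus>\<^bsub>null_quotient function_space\<^esub> A') = J A \<oplus>\<^bsub>B\<^esub> J A'"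
      using v w B.submoduleE(5)[OF difference_span_submodule v(1) w(1)] by (simp add: J)
  qed
  then show ?thesis by blast
qed

text \<open>The labels are closed under composition with \<open>f\<close> because adding constants to functionals
  absorbs the translation part of the affine isometry that \<open>f\<close> becomes in \<open>B\<close>.\<close>

lemma labelled_partitions_hom_pullback:
  assumes f: "f \<in> X \<rightarrow> X"
    and U: "linear_isometric_embedding K B B U" and c: "c \<in> carrier B"
    and equivariant: "\<And>x. x \<in> X \<Longrightarrow> b (f x) = U (b x) \<oplus>\<^bsub>B\<^esub> c"
  shows "labelled_partitions_hom X labels function_space X labels function_space f"
proof -
  note UD = linear_isometric_embeddingD[OF U]
  have label_f: "l (b (f x)) = l (U (b x)) + l c" if "bounded_functional K B l" "x \<in> X" for l x
    using that by (simp add: equivariant bounded_functionalD(2) b_mem UD(1) c)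
  have comp: "compose X (label l a) f = label (\<lambda>v. l (U v)) (l c + a)"
    if "bounded_functional K B l" for l a
    using f that by (auto simp: compose_def label_def label_f fun_eq_iff)
  have comp_mem: "bounded_functional K B (\<lambda>v. l (U v))" "l c + a \<in> K"
    if "bounded_functional K B l" "a \<in> K" for l a
    using bounded_functional_compose_isometry[OF that(1) U]
      B.scalar_mem(3)[OF bounded_functionalD(1)[OF that(1) c] that(2)] by simp_all
  have span: "U v \<in> difference_span" if v: "v \<in> difference_span" for v
  proof -
    have "l (U v) = 0" if l: "bounded_functional K B l"
      and const: "\<And>x y. x \<in> X \<Longrightarrow> y \<in> X \<Longrightarrow> l (b x) = l (b y)" for l
    proof (rule difference_spanD[OF v bounded_functional_compose_isometry[OF l U]])
      fix x y assume "x \<in> X" "y \<in> X"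
      then show "l (U (b x)) = l (U (b y))"
        using const[of "f x" "f y"] f label_f[OF l] by (auto simp: Pi_iff)
    qed
    then show ?thesis
      using UD(1)[OF difference_span_subset[OF v]] unfolding difference_span_def by blast
  qed
  have eval: "compose labels (evaluation v) (\<lambda>p. compose X p f) = evaluation (U v)"
    if v: "v \<in> difference_span" for v
  proof (rule evaluation_eqI[OF span[OF v]])
    fix l a assume l: "bounded_functional K B l" "a \<in> K"
    have "compose labels (evaluation v) (\<lambda>p. compose X p f) (label l a) =
        evaluation v (label (\<lambda>v. l (U v)) (l c + a))"
      using l by (simp add: compose_eq label_mem comp)
    also have "\<dots> = l (U v)"
      by (rule evaluation_label[OF v comp_mem[OF l]])
    finally show "compose labels (evaluation v) (\<lambda>p. compose X p f) (label l a) = l (U v)" .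
  qed (simp add: compose_def)
  show ?thesis
    unfolding labelled_partitions_hom_def
  proof (intro conjI ballI f)
    show "compose X p f \<in> labels" if "p \<in> labels" for p
      using that comp comp_mem label_mem by (auto elim!: labelsE)
    fix \<xi> assume "\<xi> \<in> carrier function_space"
    then obtain v where v: "v \<in> difference_span" "\<xi> = evaluation v"
      by (auto simp: function_space_def)
    show "compose labels \<xi> (\<lambda>p. compose X p f) \<in> carrier function_space"
      using v by (simp add: eval evaluation_mem span)
    show "vnorm function_space (compose labels \<xi> (\<lambda>p. compose X p f)) = vnorm function_space \<xi>"
      using v by (simp add: eval vnorm_evaluation span UD(4) difference_span_subset)
  qed
qed

end


section \<open>From affine isometric actions to labelled partitions\<close>

lemma affine_isometry_linear_part:
  assumes B: "seminormed_space K B" and A: "affine_isometry K B A"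
  obtains U c where "linear_isometric_embedding K B B U" "c \<in> carrier B"
    and "\<And>x. x \<in> carrier B \<Longrightarrow> A x = U x \<oplus>\<^bsub>B\<^esub> c"
proof -
  interpret seminormed_space K B by (rule B)
  obtain L c where L: "linear_map K B B L" and c: "c \<in> carrier B"
    and A_eq: "\<And>x. x \<in> carrier B \<Longrightarrow> A x = L x \<oplus>\<^bsub>B\<^esub> c"
    and iso: "\<And>x y. x \<in> carrier B \<Longrightarrow> y \<in> carrier B \<Longrightarrow> vdist B (A x) (A y) = vdist B x y"
    using A unfolding affine_isometry_def by blast
  have "vnorm B (L x) = vnorm B x" if x: "x \<in> carrier B" for x
  proof -
    have "vnorm B (L x) = vdist B (A x) (A \<zero>\<^bsub>B\<^esub>)"
      using x c linear_mapD(1)[OF L] linear_map_zero[OF B B L]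
      by (simp add: A_eq vdist_eq add_minus_add_right minus_zero_right del: M.l_zero)
    also have "\<dots> = vnorm B x"
      using x by (simp add: iso vdist_eq minus_zero_right)
    finally show ?thesis .
  qed
  with L c A_eq show thesis
    by (intro that[of L c]) (auto simp: linear_isometric_embedding_def)
qed

lemma labelled_partitions_hom_cong:
  assumes "\<And>x. x \<in> X \<Longrightarrow> f x = f' x"
  shows "labelled_partitions_hom X P V X' P' V' f \<longleftrightarrow> labelled_partitions_hom X P V X' P' V' f'"
proof -
  have "compose X p f = compose X p f'" for p :: "'b \<Rightarrow> complex"
    using assms by (auto simp: compose_def fun_eq_iff)
  moreover have "f \<in> X \<rightarrow> X' \<longleftrightarrow> f' \<in> X \<rightarrow> X'"
    using assms by (auto simp: Pi_iff)
  ultimately show ?thesis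
    unfolding labelled_partitions_hom_def by simp
qed

lemma group_actionI:
  assumes G: "group G"
    and ext: "\<And>g. g \<in> carrier G \<Longrightarrow> \<phi> g \<in> extensional E"
    and mem: "\<And>g x. g \<in> carrier G \<Longrightarrow> x \<in> E \<Longrightarrow> \<phi> g x \<in> E"
    and one: "\<And>x. x \<in> E \<Longrightarrow> \<phi> \<one>\<^bsub>G\<^esub> x = x"
    and mult: "\<And>g h x. g \<in> carrier G \<Longrightarrow> h \<in> carrier G \<Longrightarrow> x \<in> E \<Longrightarrow> \<phi> (g \<otimes>\<^bsub>G\<^esub> h) x = \<phi> g (\<phi> h x)"
  shows "group_action G E \<phi>"
proof -
  interpret group G by (rule G)
  have inverse: "\<phi> g (\<phi> (inv\<^bsub>G\<^esub> g) x) = x" "\<phi> (inv\<^bsub>G\<^esub> g) (\<phi> g x) = x"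
    if "g \<in> carrier G" "x \<in> E" for g x
    using that mult[of g "inv\<^bsub>G\<^esub> g" x] mult[of "inv\<^bsub>G\<^esub> g" g x] one by simp_all
  have bij: "\<phi> g \<in> Bij E" if g: "g \<in> carrier G" for g
  proof -
    have "bij_betw (\<phi> g) E E"
      using g by (intro bij_betw_byWitness[of _ "\<phi> (inv\<^bsub>G\<^esub> g)"]) (auto simp: inverse mem)
    then show ?thesis
      using ext[OF g] by (simp add: Bij_def)
  qed
  have "\<phi> (g \<otimes>\<^bsub>G\<^esub> h) = compose E (\<phi> g) (\<phi> h)" if "g \<in> carrier G" "h \<in> carrier G" for g h
    using that ext by (intro extensionalityI[of _ E]) (simp_all add: mult compose_eq)
  then have "\<phi> \<in> hom G (BijGroup E)"
    using bij by (auto simp: hom_def BijGroup_def)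
  then show ?thesis
    by (intro group_action.intro group_hom.intro group_hom_axioms.intro G group_BijGroup)
qed

lemma left_action_group_action:
  assumes "group G"
  shows "group_action G (carrier G) (left_action G)"
proof -
  interpret group G by (rule assms)
  show ?thesis
    by (rule group_actionI[OF assms]) (simp_all add: left_action_def m_assoc)
qed

lemma inv_into_group_action:
  assumes "group_action G E \<phi>" "g \<in> carrier G" "x \<in> E"
  shows "inv_into E (\<phi> g) x = \<phi> (inv\<^bsub>G\<^esub> g) x"
proof -
  interpret group_action G E \<phi> by (rule assms)
  interpret G: group G
    using group_hom by (simp add: group_hom_def)
  have "x = \<phi> g (\<phi> (inv\<^bsub>G\<^esub> g) x)"
    using composition_rule[OF assms(3,2), of "inv\<^bsub>G\<^esub> g"] assms(2,3) id_eq_one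
    by (metis G.inv_closed G.r_inv restrict_apply')
  then show ?thesis
    using inj_prop[OF assms(2)] element_image[OF _ assms(3)] assms(2)
    by (metis G.inv_closed inv_into_f_f)
qed

text \<open>The labels are pulled back along the orbit map of the origin; every orbit map intertwines left
  translation by \<open>g\<close> on \<open>G\<close> with the affine isometry \<open>\<alpha> g\<close>.\<close>

theorem labelled_partitions_of_affine_action:
  fixes G :: "('g, 'm) monoid_scheme" and B :: "('v, 'z) normed_module_scheme"
  assumes K: "K = \<real> \<or> K = UNIV"
    and G: "topological_group G T"
    and B: "banach_space K B"
    and \<alpha>: "continuous_affine_isometric_action K G T B \<alpha>"
  shows "\<exists>P V. labelled_partitions_space K (carrier G) P V \<and>
    continuous_automorphism_action G T (carrier G) P V (left_action G) \<and>
    (metrically_proper T (carrier B) (vdist B) \<alpha> \<longrightarrow>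
       metrically_proper T (carrier G) (labelled_partitions_dist P V) (left_action G)) \<and>
    (\<exists>J. linear_isometric_embedding K (null_quotient V) B J)"
proof -
  interpret G: group G
    using G by (simp add: topological_group_def)
  have T: "topspace T = carrier G"
    using G by (simp add: topological_group_def)
  have act: "group_action G (carrier B) \<alpha>"
    and isom: "\<And>g. g \<in> carrier G \<Longrightarrow> affine_isometry K B (\<alpha> g)"
    and cont: "\<And>x. x \<in> carrier B \<Longrightarrow>
      continuous_map T (pseudometric_topology (carrier B) (vdist B)) (\<lambda>g. \<alpha> g x)"
    using \<alpha> unfolding continuous_affine_isometric_action_def continuous_orbit_maps_def by blast+
  interpret A: group_action G "carrier B" \<alpha> by (rule act)
  interpret N: normed_space K B
    using B by (simp add: banach_space_def)
  note sn = N.seminormed_space_axioms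
  define b where "b g = \<alpha> g \<zero>\<^bsub>B\<^esub>" for g
  have \<alpha>_mem: "\<alpha> g x \<in> carrier B" if "g \<in> carrier G" "x \<in> carrier B" for g x
    using A.element_image[OF that refl] by simp
  have b_mem: "b g \<in> carrier B" if "g \<in> carrier G" for g
    using that by (simp add: b_def \<alpha>_mem)
  have b_mult: "b (g \<otimes>\<^bsub>G\<^esub> h) = \<alpha> g (b h)" if "g \<in> carrier G" "h \<in> carrier G" for g h
    unfolding b_def using that by (intro A.composition_rule) auto
  interpret L: labelled_pullback K B "carrier G" b
    by unfold_locales (use K B b_mem in auto)
  let ?d = "labelled_partitions_dist L.labels L.function_space"
  have d: "?d g h = vdist B (b g) (b h)" if "g \<in> carrier G" "h \<in> carrier G" for g h
    using that by (rule L.labelled_partitions_dist_pullback)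
  have left: "group_action G (carrier G) (left_action G)"
    by (rule left_action_group_action) (rule G.group_axioms)
  interpret Left: group_action G "carrier G" "left_action G" by (rule left)
  have hom: "labelled_partitions_hom (carrier G) L.labels L.function_space
      (carrier G) L.labels L.function_space (left_action G g)" if g: "g \<in> carrier G" for g
  proof -
    obtain U c where "linear_isometric_embedding K B B U" "c \<in> carrier B"
        "\<And>x. x \<in> carrier B \<Longrightarrow> \<alpha> g x = U x \<oplus>\<^bsub>B\<^esub> c"
      using affine_isometry_linear_part[OF sn isom[OF g]] by blast
    then show ?thesis
      using g by (intro L.labelled_partitions_hom_pullback[of _ U c])
        (auto simp: left_action_def b_mult b_mem)
  qed
  have aut: "labelled_partitions_aut (carrier G) L.labels L.function_space (left_action G g)"
    if g: "g \<in> carrier G" for g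
    unfolding labelled_partitions_aut_def
  proof (intro conjI hom[OF g])
    show "bij_betw (left_action G g) (carrier G) (carrier G)"
      using Left.bij_prop0[OF g] by (simp add: Bij_def)
    show "labelled_partitions_hom (carrier G) L.labels L.function_space
      (carrier G) L.labels L.function_space (inv_into (carrier G) (left_action G g))"
      using hom[of "inv\<^bsub>G\<^esub> g"] g inv_into_group_action[OF left g]
      by (subst labelled_partitions_hom_cong[of _ _ "left_action G (inv\<^bsub>G\<^esub> g)"]) auto
  qed
  have "continuous_orbit_maps T (carrier G) ?d (left_action G)"
    unfolding continuous_orbit_maps_def
  proof
    fix h assume h: "h \<in> carrier G"
    have "\<exists>W. openin T W \<and> t \<in> W \<and> (\<forall>s\<in>W. vdist B (\<alpha> t (b h)) (\<alpha> s (b h)) < e)"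
      if "t \<in> carrier G" "e > 0" for t e
      using cont[OF b_mem[OF h]] that
        continuous_map_pseudometric_iff[OF N.vdist_self N.vdist_triangle, where T = T and f = "\<lambda>g. \<alpha> g (b h)"]
      by (simp add: T)
    moreover have "?d (left_action G t h) (left_action G s h) = vdist B (\<alpha> t (b h)) (\<alpha> s (b h))"
      if "t \<in> carrier G" "s \<in> carrier G" for t s
      using that h by (simp add: left_action_def d b_mult)
    moreover have "W \<subseteq> carrier G" if "openin T W" for W
      using openin_subset[OF that] by (simp add: T)
    ultimately have ex: "\<exists>W. openin T W \<and> t \<in> W \<and> (\<forall>s\<in>W. ?d (left_action G t h) (left_action G s h) < e)"
      if "t \<in> carrier G" "e > 0" for t e
      using that by (metis (no_types, lifting) subsetD)
    show "continuous_map T (pseudometric_topology (carrier G) ?d) (\<lambda>g. left_action G g h)"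
    proof (subst continuous_map_pseudometric_iff)
      show "(\<lambda>g. left_action G g h) \<in> topspace T \<rightarrow> carrier G \<and> (\<forall>t\<in>topspace T. \<forall>e>0.
          \<exists>W. openin T W \<and> t \<in> W \<and> (\<forall>s\<in>W. ?d (left_action G t h) (left_action G s h) < e))"
        using ex h by (auto simp: T left_action_def)
    qed (simp_all add: d b_mem N.vdist_self N.vdist_triangle)
  qed
  moreover have "metrically_proper T (carrier G) ?d (left_action G)"
    if proper: "metrically_proper T (carrier B) (vdist B) \<alpha>"
  proof -
    obtain x0 where x0: "x0 \<in> carrier B"
      and compact: "\<And>R. R \<ge> 0 \<Longrightarrow> compactin T (T closure_of {g \<in> topspace T. vdist B (\<alpha> g x0) x0 \<le> R})"
      using proper unfolding metrically_proper_def by blast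
    have "compactin T (T closure_of {g \<in> topspace T. ?d (left_action G g \<one>\<^bsub>G\<^esub>) \<one>\<^bsub>G\<^esub> \<le> R})"
      if "R \<ge> 0" for R
    proof (rule closed_compactin)
      \<comment> \<open>Replacing the origin by \<open>x0\<close> moves both the point and its image under \<open>\<alpha> g\<close> by
        \<open>vnorm B x0\<close>.\<close>
      let ?R = "R + 2 * vnorm B x0"
      show "compactin T (T closure_of {g \<in> topspace T. vdist B (\<alpha> g x0) x0 \<le> ?R})"
        using that N.vnorm_nonneg[OF x0] by (intro compact) simp
      show "T closure_of {g \<in> topspace T. ?d (left_action G g \<one>\<^bsub>G\<^esub>) \<one>\<^bsub>G\<^esub> \<le> R} \<subseteq>
          T closure_of {g \<in> topspace T. vdist B (\<alpha> g x0) x0 \<le> ?R}"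
      proof (rule closure_of_mono, rule subsetI)
        fix g assume "g \<in> {g \<in> topspace T. ?d (left_action G g \<one>\<^bsub>G\<^esub>) \<one>\<^bsub>G\<^esub> \<le> R}"
        then have g: "g \<in> topspace T" and le: "?d (left_action G g \<one>\<^bsub>G\<^esub>) \<one>\<^bsub>G\<^esub> \<le> R"
          by simp_all
        then have gG: "g \<in> carrier G"
          by (simp add: T)
        have "b \<one>\<^bsub>G\<^esub> = \<zero>\<^bsub>B\<^esub>"
          using A.id_eq_one by (metis N.M.zero_closed b_def restrict_apply')
        then have "vdist B (b g) \<zero>\<^bsub>B\<^esub> \<le> R"
          using le gG by (simp add: left_action_def d)
        moreover have "vdist B (\<alpha> g x0) (b g) = vnorm B x0"
          using isom[OF gG] x0 by (simp add: affine_isometry_def b_def N.vdist_eq N.minus_zero_right)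
        moreover have "vdist B \<zero>\<^bsub>B\<^esub> x0 = vnorm B x0"
          using x0 by (simp add: N.vdist_commute[of _ x0]) (simp add: N.vdist_eq N.minus_zero_right)
        moreover have "vdist B (\<alpha> g x0) x0 \<le> vdist B (\<alpha> g x0) (b g) + vdist B (b g) x0"
          "vdist B (b g) x0 \<le> vdist B (b g) \<zero>\<^bsub>B\<^esub> + vdist B \<zero>\<^bsub>B\<^esub> x0"
          using gG x0 by (auto intro!: N.vdist_triangle simp: \<alpha>_mem b_mem)
        ultimately show "g \<in> {g \<in> topspace T. vdist B (\<alpha> g x0) x0 \<le> ?R}"
          using g by auto
      qed
    qed simp
    then show ?thesis
      unfolding metrically_proper_def by blast
  qed
  ultimately show ?thesis
    using L.labelled_partitions_space_pullback left aut L.null_quotient_embeds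
    unfolding continuous_automorphism_action_def by blast
qed



section \<open>Isometric representations and cocycles\<close>

context seminormed_space
begin

abbreviation norm_topology :: "'v topology" where
  "norm_topology \<equiv> pseudometric_topology (carrier V) (vdist V)"

lemma continuous_map_norm_topology:
  "continuous_map T norm_topology f \<longleftrightarrow>
    f \<in> topspace T \<rightarrow> carrier V \<and>
    (\<forall>t\<in>topspace T. \<forall>e>0. \<exists>W. openin T W \<and> t \<in> W \<and> (\<forall>s\<in>W. vdist V (f t) (f s) < e))"
  by (rule continuous_map_pseudometric_iff) (simp_all add: vdist_self vdist_triangle)

lemma continuous_map_vadd:
  assumes f: "continuous_map T norm_topology f" and h: "continuous_map T norm_topology h"
  shows "continuous_map T norm_topology (\<lambda>t. f t \<oplus> h t)"
  unfolding continuous_map_norm_topology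
proof (intro conjI ballI allI impI)
  have f_mem: "f t \<in> carrier V" and h_mem: "h t \<in> carrier V" if "t \<in> topspace T" for t
    using f h that unfolding continuous_map_norm_topology by auto
  then show "(\<lambda>t. f t \<oplus> h t) \<in> topspace T \<rightarrow> carrier V" by simp
  fix t and e :: real assume t: "t \<in> topspace T" and e: "e > 0"
  obtain W1 where W1: "openin T W1" "t \<in> W1" "\<forall>s\<in>W1. vdist V (f t) (f s) < e / 2"
    using f t half_gt_zero[OF e] unfolding continuous_map_norm_topology by blast
  obtain W2 where W2: "openin T W2" "t \<in> W2" "\<forall>s\<in>W2. vdist V (h t) (h s) < e / 2"
    using h t half_gt_zero[OF e] unfolding continuous_map_norm_topology by blast
  have "vdist V (f t \<oplus> h t) (f s \<oplus> h s) < e" if s: "s \<in> W1 \<inter> W2" for s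
  proof -
    have sT: "s \<in> topspace T"
      using s openin_subset[OF W1(1)] by blast
    note mem = f_mem[OF t] f_mem[OF sT] h_mem[OF t] h_mem[OF sT]
    have "vdist V (f t \<oplus> h t) (f s \<oplus> h s) \<le>
        vdist V (f t \<oplus> h t) (f s \<oplus> h t) + vdist V (f s \<oplus> h t) (f s \<oplus> h s)"
      using mem by (intro vdist_triangle) simp_all
    moreover have "vdist V (f t \<oplus> h t) (f s \<oplus> h t) = vdist V (f t) (f s)"
      using mem by (simp add: vdist_eq add_minus_add_right)
    moreover have "vdist V (f s \<oplus> h t) (f s \<oplus> h s) = vdist V (h t) (h s)"
      using mem by (simp add: M.a_comm[of "f s"] vdist_eq add_minus_add_right)
    moreover have "vdist V (f t) (f s) < e / 2" "vdist V (h t) (h s) < e / 2"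
      using W1(3) W2(3) s by auto
    ultimately show ?thesis by linarith
  qed
  then show "\<exists>W. openin T W \<and> t \<in> W \<and> (\<forall>s\<in>W. vdist V (f t \<oplus> h t) (f s \<oplus> h s) < e)"
    using W1 W2 by (intro exI[of _ "W1 \<inter> W2"]) auto
qed

lemma continuous_map_smult:
  assumes a: "a \<in> K" and f: "continuous_map T norm_topology f"
  shows "continuous_map T norm_topology (\<lambda>t. a \<odot>\<^bsub>V\<^esub> f t)"
  unfolding continuous_map_norm_topology
proof (intro conjI ballI allI impI)
  have mem: "f t \<in> carrier V" if "t \<in> topspace T" for t
    using f that unfolding continuous_map_norm_topology by auto
  then show "(\<lambda>t. a \<odot>\<^bsub>V\<^esub> f t) \<in> topspace T \<rightarrow> carrier V"
    using a by (simp add: smult_mem)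
  fix t and e :: real assume t: "t \<in> topspace T" and e: "e > 0"
  have "e / (cmod a + 1) > 0"
    using e by (intro divide_pos_pos) (auto intro: add_nonneg_pos)
  then obtain W where W: "openin T W" "t \<in> W" "\<forall>s\<in>W. vdist V (f t) (f s) < e / (cmod a + 1)"
    using f t unfolding continuous_map_norm_topology by blast
  have "vdist V (a \<odot>\<^bsub>V\<^esub> f t) (a \<odot>\<^bsub>V\<^esub> f s) < e" if s: "s \<in> W" for s
  proof -
    have sm: "f s \<in> carrier V"
      using s openin_subset[OF W(1)] mem by blast
    note tm = mem[OF t]
    have "a \<odot>\<^bsub>V\<^esub> f t \<ominus> a \<odot>\<^bsub>V\<^esub> f s = a \<odot>\<^bsub>V\<^esub> (f t \<ominus> f s)"
      using a tm sm smult_r_distr[of a "f t" "\<ominus> f s"] smult_r_minus[of a "f s"]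
      by (simp add: a_minus_def)
    then have "vdist V (a \<odot>\<^bsub>V\<^esub> f t) (a \<odot>\<^bsub>V\<^esub> f s) = cmod a * vdist V (f t) (f s)"
      using a tm sm by (simp add: vdist_eq smult_mem vnorm_smult minus_mem)
    also have "\<dots> \<le> (cmod a + 1) * vdist V (f t) (f s)"
      using vnorm_nonneg[OF minus_mem[OF tm sm]] tm sm by (simp add: vdist_eq algebra_simps)
    also have "\<dots> < (cmod a + 1) * (e / (cmod a + 1))"
      by (intro mult_strict_left_mono W(3)[rule_format, OF s]) (auto intro: add_nonneg_pos)
    also have "\<dots> = e"
      by (metis add_nonneg_pos less_numeral_extra(1) less_numeral_extra(3) nonzero_mult_div_cancel_left
          norm_ge_zero times_divide_eq_right)
    finally show ?thesis .
  qed
  then show "\<exists>W. openin T W \<and> t \<in> W \<and> (\<forall>s\<in>W. vdist V (a \<odot>\<^bsub>V\<^esub> f t) (a \<odot>\<^bsub>V\<^esub> f s) < e)"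
    using W by blast
qed

lemma uminus_eq_smult:
  assumes "x \<in> carrier V"
  shows "\<ominus> x = (- 1) \<odot>\<^bsub>V\<^esub> x"
  using smult_l_minus[of 1 x] assms scalar_mem(2) by (simp add: scalar_uminus smult_scalar_one)

lemma continuous_map_vminus:
  assumes f: "continuous_map T norm_topology f" and h: "continuous_map T norm_topology h"
  shows "continuous_map T norm_topology (\<lambda>t. f t \<ominus> h t)"
proof (rule continuous_map_eq)
  show "continuous_map T norm_topology (\<lambda>t. f t \<oplus> (- 1) \<odot>\<^bsub>V\<^esub> h t)"
    by (intro continuous_map_vadd continuous_map_smult f h scalar_uminus(2) scalar_mem)
  show "f t \<oplus> (- 1) \<odot>\<^bsub>V\<^esub> h t = f t \<ominus> h t" if "t \<in> topspace T" for t
    using h that uminus_eq_smult[of "h t"] unfolding continuous_map_norm_topology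
    by (auto simp: a_minus_def Pi_iff)
qed

end

lemma continuous_map_submodule_iff:
  assumes V: "normed_space K V" and S: "submodule S (scalar_ring K) V"
    and f: "f \<in> topspace T \<rightarrow> S"
  shows "continuous_map T (pseudometric_topology S (vdist (V\<lparr>carrier := S\<rparr>))) f \<longleftrightarrow>
    continuous_map T (pseudometric_topology (carrier V) (vdist V)) f"
proof -
  interpret V: normed_space K V by (rule V)
  have W: "normed_space K (V\<lparr>carrier := S\<rparr>)"
    by (rule normed_space_submodule[OF V S])
  interpret W: normed_space K "V\<lparr>carrier := S\<rparr>" by (rule W)
  have "(\<exists>U. openin T U \<and> t \<in> U \<and> (\<forall>s\<in>U. vdist (V\<lparr>carrier := S\<rparr>) (f t) (f s) < e)) \<longleftrightarrow>
      (\<exists>U. openin T U \<and> t \<in> U \<and> (\<forall>s\<in>U. vdist V (f t) (f s) < e))"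
    if "t \<in> topspace T" for t e
  proof -
    have "vdist (V\<lparr>carrier := S\<rparr>) (f t) (f s) = vdist V (f t) (f s)" if "s \<in> topspace T" for s
      using f \<open>t \<in> topspace T\<close> that
      by (intro vdist_submodule[OF V.seminormed_space_axioms S]) auto
    then show ?thesis
      using openin_subset by (metis subsetD)
  qed
  moreover have "f \<in> topspace T \<rightarrow> carrier V"
    using f V.submoduleE(1)[OF S] by blast
  ultimately show ?thesis
    using W.continuous_map_norm_topology[of T f] V.continuous_map_norm_topology[of T f] f by simp
qed

locale isometric_representation = F: normed_space K F
  for K :: "complex set" and F :: "('v, 'z) normed_module_scheme" +
  fixes G :: "('g, 'm) monoid_scheme" and T :: "'g topology" and \<pi> :: "'g \<Rightarrow> 'v \<Rightarrow> 'v"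
  assumes topological_group: "topological_group G T"
    and isometry: "g \<in> carrier G \<Longrightarrow> linear_isometric_embedding K F F (\<pi> g)"
    and one: "x \<in> carrier F \<Longrightarrow> \<pi> \<one>\<^bsub>G\<^esub> x = x"
    and mult: "g \<in> carrier G \<Longrightarrow> h \<in> carrier G \<Longrightarrow> x \<in> carrier F \<Longrightarrow> \<pi> (g \<otimes>\<^bsub>G\<^esub> h) x = \<pi> g (\<pi> h x)"
begin

sublocale G: group G
  using topological_group by (simp add: topological_group_def)

lemma topspace: "topspace T = carrier G"
  using topological_group by (simp add: topological_group_def)

lemmas \<pi>D = linear_isometric_embeddingD[OF isometry]

lemma \<pi>_zero: "g \<in> carrier G \<Longrightarrow> \<pi> g \<zero>\<^bsub>F\<^esub> = \<zero>\<^bsub>F\<^esub>"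
  using isometry linear_map_zero[OF F.seminormed_space_axioms F.seminormed_space_axioms]
  unfolding linear_isometric_embedding_def by blast

text \<open>The representation need not be strongly continuous on all of \<open>F\<close>. Every affine action below is
  restricted to this subspace.\<close>

definition continuous_vectors :: "'v set" where
  "continuous_vectors = {x \<in> carrier F. continuous_map T F.norm_topology (\<lambda>g. \<pi> g x)}"

lemma continuous_vectors_submodule: "submodule continuous_vectors (scalar_ring K) F"
proof (rule F.submoduleI)
  have smult: "a \<odot>\<^bsub>F\<^esub> x \<in> continuous_vectors" if a: "a \<in> K" and x: "x \<in> continuous_vectors" for a x
  proof -
    have xF: "x \<in> carrier F" and cont: "continuous_map T F.norm_topology (\<lambda>g. \<pi> g x)"
      using x by (auto simp: continuous_vectors_def)
    have "continuous_map T F.norm_topology (\<lambda>g. \<pi> g (a \<odot>\<^bsub>F\<^esub> x))"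
      using \<pi>D(3)[OF _ a xF] by (intro continuous_map_eq[OF F.continuous_map_smult[OF a cont]]) (simp add: topspace)
    then show ?thesis
      using F.smult_mem[OF a xF] by (simp add: continuous_vectors_def)
  qed
  show "a \<odot>\<^bsub>F\<^esub> x \<in> continuous_vectors" if "a \<in> carrier (scalar_ring K)" "x \<in> continuous_vectors" for a x
    using that by (intro smult) simp_all
  show "\<ominus>\<^bsub>F\<^esub> x \<in> continuous_vectors" if "x \<in> continuous_vectors" for x
    using smult[OF F.scalar_uminus(2)[OF F.scalar_mem(2)] that] that
    by (simp add: F.uminus_eq_smult continuous_vectors_def)
  show "\<zero>\<^bsub>F\<^esub> \<in> continuous_vectors"
  proof -
    have "\<zero>\<^bsub>F\<^esub> = \<pi> g \<zero>\<^bsub>F\<^esub>" if "g \<in> topspace T" for g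
      using that by (simp add: \<pi>_zero topspace)
    then have "continuous_map T F.norm_topology (\<lambda>g. \<pi> g \<zero>\<^bsub>F\<^esub>)"
      by (rule continuous_map_eq[rotated]) (simp_all add: topspace_pseudometric_topology)
    then show ?thesis
      by (simp add: continuous_vectors_def)
  qed
  show "x \<oplus>\<^bsub>F\<^esub> y \<in> continuous_vectors" if "x \<in> continuous_vectors" "y \<in> continuous_vectors" for x y
  proof -
    have mem: "x \<in> carrier F" "y \<in> carrier F"
      and cont: "continuous_map T F.norm_topology (\<lambda>g. \<pi> g x)" "continuous_map T F.norm_topology (\<lambda>g. \<pi> g y)"
      using that by (auto simp: continuous_vectors_def)
    have "continuous_map T F.norm_topology (\<lambda>g. \<pi> g (x \<oplus>\<^bsub>F\<^esub> y))"
      using \<pi>D(2)[OF _ mem]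
      by (intro continuous_map_eq[OF F.continuous_map_vadd[OF cont]]) (simp add: topspace)
    then show ?thesis
      using mem by (simp add: continuous_vectors_def)
  qed
qed (simp add: continuous_vectors_def)

text \<open>As all \<open>\<pi> g\<close> are isometries, the orbit map of \<open>x\<close> is a uniform limit of orbit maps of
  continuous vectors approximating \<open>x\<close>.\<close>

lemma continuous_vectors_closed: "closed_subspace K continuous_vectors F"
proof (rule closed_subspaceI[OF F.normed_space_axioms continuous_vectors_submodule])
  fix x assume x: "x \<in> carrier F" and close: "\<And>e. e > 0 \<Longrightarrow> \<exists>y\<in>continuous_vectors. vdist F x y < e"
  have "\<exists>W. openin T W \<and> t \<in> W \<and> (\<forall>s\<in>W. vdist F (\<pi> t x) (\<pi> s x) < e)"
    if t: "t \<in> topspace T" and e: "e > 0" for t e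
  proof -
    obtain y where y: "y \<in> continuous_vectors" and xy: "vdist F x y < e / 3"
      using close[of "e / 3"] e by auto
    then have yF: "y \<in> carrier F" and "continuous_map T F.norm_topology (\<lambda>g. \<pi> g y)"
      by (auto simp: continuous_vectors_def)
    then obtain W where W: "openin T W" "t \<in> W" "\<And>s. s \<in> W \<Longrightarrow> vdist F (\<pi> t y) (\<pi> s y) < e / 3"
      using t e unfolding F.continuous_map_norm_topology by (metis divide_pos_pos zero_less_numeral)
    have "vdist F (\<pi> t x) (\<pi> s x) < e" if s: "s \<in> W" for s
    proof -
      have sG: "s \<in> carrier G" and tG: "t \<in> carrier G"
        using s t openin_subset[OF W(1)] by (auto simp: topspace)
      note mem = \<pi>D(1)[OF sG x] \<pi>D(1)[OF tG x] \<pi>D(1)[OF sG yF] \<pi>D(1)[OF tG yF]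
      have "vdist F (\<pi> t x) (\<pi> s x) \<le> vdist F (\<pi> t x) (\<pi> t y) + vdist F (\<pi> t y) (\<pi> s x)"
        using mem by (intro F.vdist_triangle)
      moreover have "vdist F (\<pi> t y) (\<pi> s x) \<le> vdist F (\<pi> t y) (\<pi> s y) + vdist F (\<pi> s y) (\<pi> s x)"
        using mem by (intro F.vdist_triangle)
      moreover have "vdist F (\<pi> t x) (\<pi> t y) = vdist F x y" "vdist F (\<pi> s y) (\<pi> s x) = vdist F x y"
        using linear_isometry_vdist[OF F.seminormed_space_axioms F.seminormed_space_axioms]
          isometry[OF sG] isometry[OF tG] x yF F.vdist_commute[OF x yF] by simp_all
      ultimately show ?thesis
        using xy W(3)[OF s] by linarith
    qed
    with W show ?thesis by blast
  qed
  then have "continuous_map T F.norm_topology (\<lambda>g. \<pi> g x)"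
    unfolding F.continuous_map_norm_topology using x \<pi>D(1) by (auto simp: topspace)
  with x show "x \<in> continuous_vectors"
    by (simp add: continuous_vectors_def)
qed

text \<open>The orbit map of \<open>\<pi> h x\<close> is the orbit map of \<open>x\<close> composed with the right translation by \<open>h\<close>.\<close>

lemma continuous_vectors_invariant:
  assumes h: "h \<in> carrier G" and x: "x \<in> continuous_vectors"
  shows "\<pi> h x \<in> continuous_vectors"
proof -
  have xF: "x \<in> carrier F" and cont: "continuous_map T F.norm_topology (\<lambda>g. \<pi> g x)"
    using x by (auto simp: continuous_vectors_def)
  have "continuous_map T (prod_topology T T) (\<lambda>g. (g, h))"
    using h by (intro continuous_map_pairedI) (simp_all add: topspace)
  then have "continuous_map T T ((\<lambda>(g, h). g \<otimes>\<^bsub>G\<^esub> h) \<circ> (\<lambda>g. (g, h)))"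
    using topological_group unfolding topological_group_def by (blast intro: continuous_map_compose)
  then have "continuous_map T F.norm_topology ((\<lambda>g. \<pi> g x) \<circ> ((\<lambda>(g, h). g \<otimes>\<^bsub>G\<^esub> h) \<circ> (\<lambda>g. (g, h))))"
    by (rule continuous_map_compose[OF _ cont])
  then have "continuous_map T F.norm_topology (\<lambda>g. \<pi> g (\<pi> h x))"
    by (rule continuous_map_eq) (simp add: topspace mult h xF)
  then show ?thesis
    using \<pi>D(1)[OF h xF] by (simp add: continuous_vectors_def)
qed

text \<open>The cocycle identity is exactly the condition for the affine maps \<open>x \<mapsto> \<pi> g x + b g\<close> to compose like
  the elements of \<open>G\<close>. At the identity it reads \<open>b 1 = b 1 + b 1\<close>, hence \<open>b 1 = 0\<close>.\<close>

theorem affine_action_of_cocycle: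
  fixes b :: "'g \<Rightarrow> 'v"
  defines "B \<equiv> F\<lparr>carrier := continuous_vectors\<rparr>"
  defines "\<alpha> \<equiv> \<lambda>g. \<lambda>x\<in>continuous_vectors. \<pi> g x \<oplus>\<^bsub>F\<^esub> b g"
  assumes b_mem: "\<And>g. g \<in> carrier G \<Longrightarrow> b g \<in> continuous_vectors"
    and cocycle: "\<And>g h. g \<in> carrier G \<Longrightarrow> h \<in> carrier G \<Longrightarrow> b (g \<otimes>\<^bsub>G\<^esub> h) = \<pi> g (b h) \<oplus>\<^bsub>F\<^esub> b g"
    and b_cont: "continuous_map T F.norm_topology b"
  shows "continuous_affine_isometric_action K G T B \<alpha>"
proof -
  let ?S = continuous_vectors
  note sub = continuous_vectors_submodule
  have S: "x \<in> carrier F" if "x \<in> ?S" for x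
    using that by (simp add: continuous_vectors_def)
  have B: "normed_space K B"
    unfolding B_def by (rule normed_space_submodule[OF F.normed_space_axioms sub])
  interpret B: normed_space K B by (rule B)
  have add_mem: "x \<oplus>\<^bsub>F\<^esub> y \<in> ?S" if "x \<in> ?S" "y \<in> ?S" for x y
    using F.submoduleE(5)[OF sub that] .
  have \<alpha>: "\<alpha> g x = \<pi> g x \<oplus>\<^bsub>F\<^esub> b g" if "x \<in> ?S" for g x
    using that by (simp add: \<alpha>_def)
  have \<alpha>_mem: "\<alpha> g x \<in> ?S" if "g \<in> carrier G" "x \<in> ?S" for g x
    using that by (simp add: \<alpha> add_mem continuous_vectors_invariant b_mem)
  have dist: "vdist B x y = vdist F x y" if "x \<in> ?S" "y \<in> ?S" for x y
    unfolding B_def by (rule vdist_submodule[OF F.seminormed_space_axioms sub that])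
  have b_one: "b \<one>\<^bsub>G\<^esub> = \<zero>\<^bsub>F\<^esub>"
  proof -
    have bF: "b \<one>\<^bsub>G\<^esub> \<in> carrier F"
      by (intro S b_mem) simp
    then have "b \<one>\<^bsub>G\<^esub> = b \<one>\<^bsub>G\<^esub> \<oplus>\<^bsub>F\<^esub> b \<one>\<^bsub>G\<^esub>"
      using cocycle[of "\<one>\<^bsub>G\<^esub>" "\<one>\<^bsub>G\<^esub>"] one by simp
    then show ?thesis
      using bF F.M.add.l_cancel_one'[of "b \<one>\<^bsub>G\<^esub>" "b \<one>\<^bsub>G\<^esub>"] by simp
  qed
  have "group_action G ?S \<alpha>"
  proof (rule group_actionI[OF G.group_axioms])
    show "\<alpha> g \<in> extensional ?S" for g
      by (simp add: \<alpha>_def)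
    show "\<alpha> \<one>\<^bsub>G\<^esub> x = x" if "x \<in> ?S" for x
      using that S[OF that] by (simp add: \<alpha> b_one one)
    show "\<alpha> (g \<otimes>\<^bsub>G\<^esub> h) x = \<alpha> g (\<alpha> h x)" if g: "g \<in> carrier G" and h: "h \<in> carrier G" and x: "x \<in> ?S" for g h x
    proof -
      note mem = S[OF x] \<pi>D(1)[OF h S[OF x]] S[OF b_mem[OF h]] S[OF b_mem[OF g]]
      have "\<alpha> g (\<alpha> h x) = \<pi> g (\<pi> h x \<oplus>\<^bsub>F\<^esub> b h) \<oplus>\<^bsub>F\<^esub> b g"
        using \<alpha>_mem[OF h x] x by (simp add: \<alpha>)
      also have "\<dots> = \<pi> g (\<pi> h x) \<oplus>\<^bsub>F\<^esub> (\<pi> g (b h) \<oplus>\<^bsub>F\<^esub> b g)"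
        using mem by (simp add: \<pi>D(1,2)[OF g] F.M.a_assoc)
      also have "\<dots> = \<alpha> (g \<otimes>\<^bsub>G\<^esub> h) x"
        using x g h by (simp add: \<alpha> cocycle mult S)
      finally show ?thesis by simp
    qed
  qed (rule \<alpha>_mem)
  moreover have "affine_isometry K B (\<alpha> g)" if g: "g \<in> carrier G" for g
    unfolding affine_isometry_def
  proof (intro conjI exI ballI bexI)
    show "linear_map K B B (\<pi> g)"
      by (rule linear_mapI) (simp_all add: B_def continuous_vectors_invariant g S \<pi>D)
    show "b g \<in> carrier B"
      using g by (simp add: B_def b_mem)
    show "\<alpha> g x = \<pi> g x \<oplus>\<^bsub>B\<^esub> b g" if "x \<in> carrier B" for x
      using that by (simp add: B_def \<alpha>)
    show "vdist B (\<alpha> g x) (\<alpha> g y) = vdist B x y" if "x \<in> carrier B" "y \<in> carrier B" for x y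
    proof -
      have xy: "x \<in> ?S" "y \<in> ?S"
        using that by (simp_all add: B_def)
      have "vdist B (\<alpha> g x) (\<alpha> g y) = vdist F (\<pi> g x \<oplus>\<^bsub>F\<^esub> b g) (\<pi> g y \<oplus>\<^bsub>F\<^esub> b g)"
        using xy g by (simp add: dist \<alpha>_mem) (simp add: \<alpha>)
      also have "\<dots> = vdist F (\<pi> g x) (\<pi> g y)"
        using xy g by (simp add: F.vdist_eq \<pi>D(1) S b_mem F.add_minus_add_right)
      also have "\<dots> = vdist B x y"
        using linear_isometry_vdist[OF F.seminormed_space_axioms F.seminormed_space_axioms isometry[OF g]]
          xy by (simp add: dist S)
      finally show ?thesis .
    qed
  qed
  moreover have "continuous_orbit_maps T (carrier B) (vdist B) \<alpha>"
    unfolding continuous_orbit_maps_def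
  proof
    fix x assume "x \<in> carrier B"
    then have x: "x \<in> ?S"
      by (simp add: B_def)
    then have "continuous_map T F.norm_topology (\<lambda>g. \<pi> g x \<oplus>\<^bsub>F\<^esub> b g)"
      by (intro F.continuous_map_vadd b_cont) (simp add: continuous_vectors_def)
    then have "continuous_map T F.norm_topology (\<lambda>g. \<alpha> g x)"
      by (simp add: \<alpha> x)
    then show "continuous_map T (pseudometric_topology (carrier B) (vdist B)) (\<lambda>g. \<alpha> g x)"
      using continuous_map_submodule_iff[OF F.normed_space_axioms sub, of "\<lambda>g. \<alpha> g x" T] \<alpha>_mem x
      by (simp add: B_def topspace)
  qed
  ultimately show ?thesis
    unfolding continuous_affine_isometric_action_def by (simp add: B_def)
qed

end


section \<open>From labelled partitions to affine isometric actions\<close>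

text \<open>A base point \<open>x0\<close> turns the separation map into an isometric map \<open>j x = [c x x0]\<close> from \<open>X\<close> to the null
  quotient, and the identity \<open>c (g x) x0 = c (g x) (g x0) + c (g x0) x0\<close> says that \<open>j\<close> intertwines the
  action on \<open>X\<close> with the affine maps with linear part \<open>\<pi> g\<close> and translation part
  \<open>j (g x0)\<close>.\<close>

theorem affine_action_of_labelled_partitions:
  fixes G :: "('g, 'm) monoid_scheme" and X :: "'x set"
  assumes G: "topological_group G T"
    and space: "labelled_partitions_space K X P V"
    and \<phi>: "continuous_automorphism_action G T X P V \<phi>"
  shows "\<exists>B \<alpha>. (\<exists>S. closed_subspace K S (null_quotient V) \<and> B = (null_quotient V)\<lparr>carrier := S\<rparr>) \<and>
    banach_space K B \<and>
    continuous_affine_isometric_action K G T B \<alpha> \<and>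
    (metrically_proper T X (labelled_partitions_dist P V) \<phi> \<longrightarrow>
       metrically_proper T (carrier B) (vdist B) \<alpha>)"
proof -
  let ?F = "null_quotient V" and ?d = "labelled_partitions_dist P V"
  interpret V: seminormed_space K V
    using space by (simp add: labelled_partitions_space_def seminormed_function_space_def)
  have F: "banach_space K ?F"
    using space by (simp add: labelled_partitions_space_def)
  interpret F: normed_space K ?F
    using F by (simp add: banach_space_def)
  have P_ext: "p \<in> extensional X" if "p \<in> P" for p
    using space that by (auto simp: labelled_partitions_space_def PiE_def)
  have V_ext: "\<xi> \<in> extensional P" if "\<xi> \<in> carrier V" for \<xi>
    using space that by (auto simp: labelled_partitions_space_def seminormed_function_space_def PiE_def)
  have V_add: "\<xi> \<oplus>\<^bsub>V\<^esub> \<eta> = (\<lambda>p\<in>P. \<xi> p + \<eta> p)" if "\<xi> \<in> carrier V" "\<eta> \<in> carrier V" for \<xi> \<eta>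
    using space that by (simp add: labelled_partitions_space_def seminormed_function_space_def)
  have V_smult: "a \<odot>\<^bsub>V\<^esub> \<xi> = (\<lambda>p\<in>P. a * \<xi> p)" if "a \<in> K" "\<xi> \<in> carrier V" for a \<xi>
    using space that by (simp add: labelled_partitions_space_def seminormed_function_space_def)
  have c_mem: "separation_map P x y \<in> carrier V" if "x \<in> X" "y \<in> X" for x y
    using space that by (simp add: labelled_partitions_space_def)
  have c_add: "separation_map P x z = separation_map P x y \<oplus>\<^bsub>V\<^esub> separation_map P y z"
    if "x \<in> X" "y \<in> X" "z \<in> X" for x y z
    unfolding V_add[OF c_mem[OF that(1,2)] c_mem[OF that(2,3)]] by (auto simp: separation_map_def)
  interpret G: group G
    using G by (simp add: topological_group_def)
  have T: "topspace T = carrier G"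
    using G by (simp add: topological_group_def)
  have act: "group_action G X \<phi>"
    and hom: "\<And>g. g \<in> carrier G \<Longrightarrow> labelled_partitions_hom X P V X P V (\<phi> g)"
    and cont: "\<And>x. x \<in> X \<Longrightarrow> continuous_map T (pseudometric_topology X ?d) (\<lambda>g. \<phi> g x)"
    using \<phi> unfolding continuous_automorphism_action_def labelled_partitions_aut_def
      continuous_orbit_maps_def by blast+
  interpret A: group_action G X \<phi> by (rule act)
  have \<phi>_mem: "\<phi> g x \<in> X" if "g \<in> carrier G" "x \<in> X" for g x
    using A.element_image[OF that refl] by simp

  define \<rho> where "\<rho> g \<xi> = compose P \<xi> (\<lambda>p. compose X p (\<phi> g))" for g and \<xi> :: "('x \<Rightarrow> complex) \<Rightarrow> complex"
  have label_mem: "compose X p (\<phi> g) \<in> P" if "g \<in> carrier G" "p \<in> P" for g p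
    using hom[OF that(1)] that(2) by (simp add: labelled_partitions_hom_def)
  have \<rho>_apply: "\<rho> g \<xi> p = \<xi> (compose X p (\<phi> g))" if "p \<in> P" for g \<xi> p
    using that by (simp add: \<rho>_def compose_eq)
  have \<rho>_ext: "\<rho> g \<xi> \<in> extensional P" for g \<xi>
    by (simp add: \<rho>_def compose_def)
  have \<rho>_mem: "\<rho> g \<xi> \<in> carrier V" if "g \<in> carrier G" "\<xi> \<in> carrier V" for g \<xi>
    using hom[OF that(1)] that(2) by (simp add: labelled_partitions_hom_def \<rho>_def)
  have \<rho>_isometry: "linear_isometric_embedding K V V (\<rho> g)" if g: "g \<in> carrier G" for g
    unfolding linear_isometric_embedding_def
  proof (intro conjI ballI linear_mapI \<rho>_mem[OF g])
    show "vnorm V (\<rho> g \<xi>) = vnorm V \<xi>" if "\<xi> \<in> carrier V" for \<xi>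
      using hom[OF g] that by (simp add: labelled_partitions_hom_def \<rho>_def)
    show "\<rho> g (\<xi> \<oplus>\<^bsub>V\<^esub> \<eta>) = \<rho> g \<xi> \<oplus>\<^bsub>V\<^esub> \<rho> g \<eta>" if "\<xi> \<in> carrier V" "\<eta> \<in> carrier V" for \<xi> \<eta>
      using that g by (intro extensionalityI[OF \<rho>_ext V_ext[OF V.M.a_closed[OF \<rho>_mem \<rho>_mem]]])
        (simp_all add: \<rho>_mem V_add \<rho>_apply label_mem)
    show "\<rho> g (a \<odot>\<^bsub>V\<^esub> \<xi>) = a \<odot>\<^bsub>V\<^esub> \<rho> g \<xi>" if "a \<in> K" "\<xi> \<in> carrier V" for a \<xi>
      using that g
      by (intro extensionalityI[OF \<rho>_ext V_ext[OF V.smult_mem[OF _ \<rho>_mem]]]) (simp_all add: \<rho>_mem V.smult_mem V_smult \<rho>_apply label_mem)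
  qed
  have \<rho>_one: "\<rho> \<one>\<^bsub>G\<^esub> \<xi> = \<xi>" if "\<xi> \<in> carrier V" for \<xi>
  proof (rule extensionalityI[OF \<rho>_ext V_ext[OF that]])
    fix p assume p: "p \<in> P"
    have "\<phi> \<one>\<^bsub>G\<^esub> x = x" if "x \<in> X" for x
      using A.id_eq_one that by (metis restrict_apply')
    then have "compose X p (\<phi> \<one>\<^bsub>G\<^esub>) = p"
      by (intro extensionalityI[OF _ P_ext[OF p]]) (auto simp: compose_def)
    then show "\<rho> \<one>\<^bsub>G\<^esub> \<xi> p = \<xi> p"
      using p by (simp add: \<rho>_apply)
  qed
  have \<rho>_mult: "\<rho> (g \<otimes>\<^bsub>G\<^esub> h) \<xi> = \<rho> g (\<rho> h \<xi>)"
    if g: "g \<in> carrier G" and h: "h \<in> carrier G" for g h \<xi>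
  proof (rule extensionalityI[OF \<rho>_ext \<rho>_ext])
    fix p assume p: "p \<in> P"
    have "compose X p (\<phi> (g \<otimes>\<^bsub>G\<^esub> h)) = compose X (compose X p (\<phi> g)) (\<phi> h)"
      using g h by (auto simp: compose_def A.composition_rule \<phi>_mem fun_eq_iff)
    then show "\<rho> (g \<otimes>\<^bsub>G\<^esub> h) \<xi> p = \<rho> g (\<rho> h \<xi>) p"
      using p g h by (simp add: \<rho>_apply label_mem)
  qed
  have \<rho>_c: "\<rho> g (separation_map P x y) = separation_map P (\<phi> g x) (\<phi> g y)"
    if "g \<in> carrier G" "x \<in> X" "y \<in> X" for g x y
    using that
    by (intro extensionalityI[OF \<rho>_ext V_ext[OF c_mem[OF \<phi>_mem \<phi>_mem]]])
      (simp_all add: \<phi>_mem \<rho>_apply separation_map_def label_mem compose_eq)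

  have "\<exists>\<pi>. linear_isometric_embedding K ?F ?F \<pi> \<and> (\<forall>\<xi>\<in>carrier V. \<pi> (V.null_coset \<xi>) = V.null_coset (\<rho> g \<xi>))"
    if "g \<in> carrier G" for g
    using induced_isometry_null_quotient[OF V.seminormed_space_axioms \<rho>_isometry[OF that]] by metis
  then obtain \<pi> where \<pi>_isometry: "\<And>g. g \<in> carrier G \<Longrightarrow> linear_isometric_embedding K ?F ?F (\<pi> g)"
    and \<pi>_coset: "\<And>g \<xi>. g \<in> carrier G \<Longrightarrow> \<xi> \<in> carrier V \<Longrightarrow> \<pi> g (V.null_coset \<xi>) = V.null_coset (\<rho> g \<xi>)"
    by metis
  interpret R: isometric_representation K ?F G T \<pi>
  proof
    fix A assume "A \<in> carrier ?F"
    then obtain \<xi> where \<xi>: "\<xi> \<in> carrier V" "A = V.null_coset \<xi>"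
      unfolding V.carrier_null_quotient by blast
    show "\<pi> \<one>\<^bsub>G\<^esub> A = A"
      using \<xi> by (simp add: \<pi>_coset \<rho>_one)
    show "\<pi> (g \<otimes>\<^bsub>G\<^esub> h) A = \<pi> g (\<pi> h A)" if "g \<in> carrier G" "h \<in> carrier G" for g h
      using \<xi> that by (simp add: \<pi>_coset \<rho>_mult \<rho>_mem)
  qed (use G \<pi>_isometry in auto)
  let ?S = R.continuous_vectors
  let ?B = "?F\<lparr>carrier := ?S\<rparr>"
  have B: "banach_space K ?B"
    by (rule banach_space_closed_subspace[OF F R.continuous_vectors_closed])

  show ?thesis
  proof (cases "X = {}")
    case True
    \<comment> \<open>Without a base point the zero cocycle is used; an action on the empty set is never proper.\<close>
    have zero: "\<zero>\<^bsub>?F\<^esub> \<in> ?S"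
      using submodule.axioms(1)[OF R.continuous_vectors_submodule, THEN subgroup.one_closed] by simp
    have "continuous_affine_isometric_action K G T ?B (\<lambda>g. \<lambda>x\<in>?S. \<pi> g x \<oplus>\<^bsub>?F\<^esub> \<zero>\<^bsub>?F\<^esub>)"
    proof (rule R.affine_action_of_cocycle)
      show "\<zero>\<^bsub>?F\<^esub> = \<pi> g \<zero>\<^bsub>?F\<^esub> \<oplus>\<^bsub>?F\<^esub> \<zero>\<^bsub>?F\<^esub>" if "g \<in> carrier G" for g
        using that by (simp add: R.\<pi>_zero)
    qed (simp_all add: zero topspace_pseudometric_topology)
    moreover have "\<not> metrically_proper T X ?d \<phi>"
      using True by (simp add: metrically_proper_def)
    ultimately show ?thesis
      using B R.continuous_vectors_closed by blast
  next
    case False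
    \<comment> \<open>If the action is proper, the base point is chosen as a witness of properness, so that the sets in
      the two properness conditions coincide.\<close>
    let ?compact = "\<lambda>x0. \<forall>R\<ge>0. compactin T (T closure_of {g \<in> topspace T. ?d (\<phi> g x0) x0 \<le> R})"
    obtain x0 where x0: "x0 \<in> X" and proper: "metrically_proper T X ?d \<phi> \<Longrightarrow> ?compact x0"
    proof (cases "metrically_proper T X ?d \<phi>")
      case True
      then obtain x0 where "x0 \<in> X" "?compact x0"
        unfolding metrically_proper_def by blast
      then show ?thesis by (rule that)
    next
      case False
      obtain x0 where "x0 \<in> X"
        using \<open>X \<noteq> {}\<close> by blast
      then show ?thesis using that False by blast
    qed
    define j where "j x = V.null_coset (separation_map P x x0)" for x
    have j_mem: "j x \<in> carrier ?F" if "x \<in> X" for x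
      using that x0 by (simp add: j_def V.null_coset_mem c_mem)
    have j_dist: "vdist ?F (j x) (j y) = ?d x y" if "x \<in> X" "y \<in> X" for x y
    proof -
      have "separation_map P x x0 = separation_map P x y \<oplus>\<^bsub>V\<^esub> separation_map P y x0"
        using that x0 by (intro c_add)
      then have "separation_map P x x0 \<ominus>\<^bsub>V\<^esub> separation_map P y x0 = separation_map P x y"
        using that x0 c_mem[of x y] c_mem[of y x0] by (simp add: a_minus_def V.M.a_assoc V.M.r_neg)
      then show ?thesis
        using linear_isometry_vdist[OF V.seminormed_space_axioms F.seminormed_space_axioms
            V.null_coset_linear_isometry, of "separation_map P x x0" "separation_map P y x0"] that x0
        by (simp add: j_def c_mem V.vdist_eq labelled_partitions_dist_def)
    qed
    have j_\<phi>: "j (\<phi> g x) = \<pi> g (j x) \<oplus>\<^bsub>?F\<^esub> j (\<phi> g x0)" if "g \<in> carrier G" "x \<in> X" for g x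
    proof -
      have "separation_map P (\<phi> g x) x0 =
          separation_map P (\<phi> g x) (\<phi> g x0) \<oplus>\<^bsub>V\<^esub> separation_map P (\<phi> g x0) x0"
        using that x0 \<phi>_mem by (intro c_add)
      then show ?thesis
        using that x0 by (simp add: j_def \<pi>_coset c_mem \<rho>_c \<phi>_mem V.add_null_quotient)
    qed
    have j_cont: "continuous_map T F.norm_topology (\<lambda>g. j (\<phi> g x))" if x: "x \<in> X" for x
    proof -
      have "\<forall>t\<in>topspace T. \<forall>e>0. \<exists>W. openin T W \<and> t \<in> W \<and> (\<forall>s\<in>W. ?d (\<phi> t x) (\<phi> s x) < e)"
        using cont[OF x]
        by (subst (asm) continuous_map_pseudometric_iff)
          (simp_all flip: j_dist add: j_mem F.vdist_self F.vdist_triangle)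
      moreover have "?d (\<phi> t x) (\<phi> s x) = vdist ?F (j (\<phi> t x)) (j (\<phi> s x))"
        if "t \<in> topspace T" "s \<in> topspace T" for t s
        using that x by (simp add: j_dist \<phi>_mem T)
      ultimately have "\<forall>t\<in>topspace T. \<forall>e>0. \<exists>W. openin T W \<and> t \<in> W \<and>
          (\<forall>s\<in>W. vdist ?F (j (\<phi> t x)) (j (\<phi> s x)) < e)"
        using openin_subset by (metis (no_types, lifting) subsetD)
      then show ?thesis
        unfolding F.continuous_map_norm_topology using x by (simp add: j_mem \<phi>_mem T)
    qed
    \<comment> \<open>The orbit map \<open>g \<mapsto> \<pi> g (j x)\<close> is the difference of the continuous maps \<open>j (\<phi> g x)\<close> and
      \<open>j (\<phi> g x0)\<close>.\<close>
    have j_S: "j x \<in> ?S" if x: "x \<in> X" for x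
    proof -
      have "continuous_map T F.norm_topology (\<lambda>g. \<pi> g (j x))"
      proof (rule continuous_map_eq[OF F.continuous_map_vminus[OF j_cont[OF x] j_cont[OF x0]]])
        fix g assume "g \<in> topspace T"
        then have g: "g \<in> carrier G" by (simp add: T)
        have "\<pi> g (j x) \<in> carrier ?F" "j (\<phi> g x0) \<in> carrier ?F"
          using R.\<pi>D(1)[OF g j_mem[OF x]] g x0 by (simp_all add: j_mem \<phi>_mem)
        then show "j (\<phi> g x) \<ominus>\<^bsub>?F\<^esub> j (\<phi> g x0) = \<pi> g (j x)"
          using j_\<phi>[OF g x] by (simp add: a_minus_def F.M.a_assoc F.M.r_neg)
      qed
      then show ?thesis
        using j_mem[OF x] by (simp add: R.continuous_vectors_def)
    qed
    define b where "b g = j (\<phi> g x0)" for g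
    define \<alpha> where "\<alpha> = (\<lambda>g. \<lambda>x\<in>?S. \<pi> g x \<oplus>\<^bsub>?F\<^esub> b g)"
    have "continuous_affine_isometric_action K G T ?B \<alpha>"
      unfolding \<alpha>_def
    proof (rule R.affine_action_of_cocycle)
      show "b g \<in> ?S" if "g \<in> carrier G" for g
        using that x0 by (simp add: b_def j_S \<phi>_mem)
      show "b (g \<otimes>\<^bsub>G\<^esub> h) = \<pi> g (b h) \<oplus>\<^bsub>?F\<^esub> b g" if "g \<in> carrier G" "h \<in> carrier G" for g h
        using that x0 j_\<phi>[of g "\<phi> h x0"] by (simp add: b_def A.composition_rule \<phi>_mem)
      show "continuous_map T F.norm_topology b"
        using j_cont[OF x0] by (simp add: b_def[abs_def])
    qed
    moreover have "metrically_proper T (carrier ?B) (vdist ?B) \<alpha>" if "metrically_proper T X ?d \<phi>"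
    proof -
      have j_x0: "j x0 \<in> ?S"
        by (rule j_S[OF x0])
      have "vdist ?B (\<alpha> g (j x0)) (j x0) = ?d (\<phi> g x0) x0" if "g \<in> topspace T" for g
      proof -
        have g: "g \<in> carrier G"
          using that by (simp add: T)
        have "\<alpha> g (j x0) = j (\<phi> g x0)"
          using j_\<phi>[OF g x0] j_x0 by (simp add: \<alpha>_def b_def)
        then show ?thesis
          using g x0 j_x0 vdist_submodule[OF F.seminormed_space_axioms R.continuous_vectors_submodule]
          by (simp add: j_S j_dist \<phi>_mem)
      qed
      then have "{g \<in> topspace T. vdist ?B (\<alpha> g (j x0)) (j x0) \<le> R} = {g \<in> topspace T. ?d (\<phi> g x0) x0 \<le> R}" for R
        by auto
      then show ?thesis
        using proper[OF that] j_x0 unfolding metrically_proper_def by (intro bexI[of _ "j x0"]) simp_all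
    qed
    ultimately show ?thesis
      using B R.continuous_vectors_closed by blast
  qed
qed


section \<open>Affine isometric actions and labelled partitions\<close>

theorem theorem1:
  fixes K :: "complex set"
    and G :: "('g, 'm) monoid_scheme"
    and T :: "'g topology"
  assumes K: "K = \<real> \<or> K = UNIV"
    and G: "topological_group G T"
  shows
    "(\<forall>(B :: 'b normed_module) \<alpha>.
        banach_space K B \<and> continuous_affine_isometric_action K G T B \<alpha> \<longrightarrow>
        (\<exists>P V. labelled_partitions_space K (carrier G) P V \<and>
               continuous_automorphism_action G T (carrier G) P V (left_action G) \<and>
               (metrically_proper T (carrier B) (vdist B) \<alpha> \<longrightarrow>
                  metrically_proper T (carrier G) (labelled_partitions_dist P V) (left_action G)) \<and>
               (\<exists>J. linear_isometric_embedding K (null_quotient V) B J))) \<and>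
     (\<forall>(X :: 'x set) P V \<phi>.
        labelled_partitions_space K X P V \<and> continuous_automorphism_action G T X P V \<phi> \<longrightarrow>
        (\<exists>B \<alpha>. (\<exists>S. closed_subspace K S (null_quotient V) \<and>
                    B = (null_quotient V)\<lparr>carrier := S\<rparr>) \<and>
               banach_space K B \<and>
               continuous_affine_isometric_action K G T B \<alpha> \<and>
               (metrically_proper T X (labelled_partitions_dist P V) \<phi> \<longrightarrow>
                  metrically_proper T (carrier B) (vdist B) \<alpha>)))"
  using labelled_partitions_of_affine_action[OF K G] affine_action_of_labelled_partitions[OF G]
  by blast

end
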